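(* For all $0<\delta<\tfrac12$ there is a constant $\tilde K(\delta)>0$ such that, for every continuous time irreducible reversible Markov chain $X$ on $I=\{1,2,\ldots,n\}$ with invariant distribution $\nu$, the inequalities $$\int_0^\infty \mathbf{1}_{\{t\geq0:\;\sum_{(a,b)\in I^2}\nu(a)\,\nu(b)\,\|P^a_t-P^b_t\|^2_{L^2(\nu^{-1})}\notin\tilde{A}_L^\delta\}}\,\frac{1}{t}\,\mathrm{d}t \leq \tilde{K}(\delta)\,n$$ and $$\int_0^\infty \mathbf{1}_{\{t\geq0:\;\|P^a_t-P^b_t\|_{L^2(\nu^{-1})}^2\notin \tilde{A}^\delta(a,b)\}}\,\frac{1}{t}\,\mathrm{d}t\leq \tilde{K}(\delta)\,n,\qquad (a,b)\in I^2,$$ hold true, where the sets $\tilde A_L^\delta$ and $\tilde A^\delta(a,b)$ are defined in the context. The constant $\tilde K(\delta)$ depends only on $\delta$, and not on $n$ or the particular Markov chain $X$.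
   Context: For $a\in I$ and $t\ge0$, $P^a_t$ denotes the distribution of $X(t)$ when $X(0)=a$, and $P_t$ is the transition matrix with entries $P_t(a,b)=P^a_t(b)$. Reversibility means the detailed balance condition $\nu(a)P^a_t(b)=\nu(b)P^b_t(a)$ for all $a,b\in I$, $t\ge0$. $\|\cdot\|_{L^2(\nu^{-1})}$ is the $L^2$ norm with respect to the weights $\nu(i)^{-1}$, $i\in I$, that is, $\|\pi\|_{L^2(\nu^{-1})}^2=\sum_{i\in I}\pi(i)^2\nu(i)^{-1}$. Let $D$ be the diagonal matrix with diagonal entries $\nu(i)$, $i\in I$. The matrices $D^{1/2}P_tD^{-1/2}$, $t\ge0$, are symmetric and commute, so they have a joint orthonormal basis of eigenvectors $v_1,v_2,\ldots,v_n$ (with respect to the Euclidean scalar product) corresponding to the eigenvalues $1,e^{-\lambda_2t},e^{-\lambda_3t},\ldots,e^{-\lambda_nt}$, respectively, where $0<\lambda_2\le\lambda_3\le\ldots\le\lambda_n$. Let $e_a$ be the vector whose only non-zero component is the $a$-th one, which equals $1$. For $(a,b)\in I^2$ the vector $D^{-1/2}(e_a-e_b)$ is orthogonal to $v_1$, and the numbers $\tilde\mu_2,\ldots,\tilde\mu_n$ (depending on $a,b$) are defined by the expansion $$D^{-1/2}(e_a-e_b)=\sum_{l=2}^n\tilde\mu_l v_l.$$ Define the sets $$\tilde A_L=\{0,1,2,\ldots,n-1\},\qquad \tilde A(a,b)=\{0,\tilde\mu_2^2,\tilde\mu_2^2+\tilde\mu_3^2,\ldots,\tilde\mu_2^2+\tilde\mu_3^2+\ldots+\tilde\mu_n^2\},$$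 and, for $0<\delta<\frac12$, their neighborhoods $$\tilde A_L^\delta=[0,\delta]\cup[1-\delta,1+\delta]\cup[2-\delta,2+\delta]\cup\ldots\cup[n-1-\delta,n-1],$$ $$\tilde A^\delta(a,b)=[0,\delta\tilde\mu_2^2]\cup[(1-\delta)\tilde\mu_2^2,\tilde\mu_2^2+\delta\tilde\mu_3^2]\cup\ldots\cup\Big[\sum_{l=2}^{n-1}\tilde\mu_l^2+(1-\delta)\tilde\mu_n^2,\;\sum_{l=2}^n\tilde\mu_l^2\Big],$$ where the intermediate intervals of $\tilde A^\delta(a,b)$ are $\big[\sum_{l=2}^{k-1}\tilde\mu_l^2+(1-\delta)\tilde\mu_k^2,\;\sum_{l=2}^{k}\tilde\mu_l^2+\delta\tilde\mu_{k+1}^2\big]$ for $k=2,\ldots,n-1$.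
   Formalization: The sum over (a,b) in I^2 carries a factor 1/2 (each unordered pair counted once): as written it tends to 2(n-1) > n-1 as t tends to 0, so the first integral is infinite for n >= 2. Chains are taken on the sample space of functions from the reals to the naturals. *)

theory Defs
  imports "HOL-Probability.Probability"
begin

text \<open>
  \<^term>\<open>M a\<close> is the law of the chain started in the state \<^term>\<open>a\<close>. The Markov property is stated
  for all finite sets of past times, in the product form that also covers conditioning events of
  probability zero. Right-continuity refers to the discrete topology on the states.
\<close>

locale markov_chain =
  fixes n :: nat
    and M :: "nat \<Rightarrow> 'w measure"
    and X :: "real \<Rightarrow> 'w \<Rightarrow> nat"
  assumes prob_space_M: "a \<in> {1..n} \<Longrightarrow> prob_space (M a)"
    and measurable_X: "a \<in> {1..n} \<Longrightarrow> 0 \<le> t \<Longrightarrow> X t \<in> measurable (M a) (count_space {1..n})"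
    and start: "a \<in> {1..n} \<Longrightarrow> AE \<omega> in M a. X 0 \<omega> = a"
    and right_continuous:
      "a \<in> {1..n} \<Longrightarrow> AE \<omega> in M a. \<forall>t\<ge>0. \<forall>\<^sub>F s in at_right t. X s \<omega> = X t \<omega>"
    and markov_property:
      "a \<in> {1..n} \<Longrightarrow> b \<in> {1..n} \<Longrightarrow> c \<in> {1..n} \<Longrightarrow> 0 \<le> s \<Longrightarrow> 0 \<le> t \<Longrightarrow>
       finite F \<Longrightarrow> F \<subseteq> {0..s} \<Longrightarrow>
       measure (M a) {\<omega> \<in> space (M a). (\<forall>r\<in>F. X r \<omega> = h r) \<and> X s \<omega> = c \<and> X (s + t) \<omega> = b} =
       measure (M a) {\<omega> \<in> space (M a). (\<forall>r\<in>F. X r \<omega> = h r) \<and> X s \<omega> = c} *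
       measure (M c) {\<omega> \<in> space (M c). X t \<omega> = b}"

definition transition :: "(nat \<Rightarrow> 'w measure) \<Rightarrow> (real \<Rightarrow> 'w \<Rightarrow> nat) \<Rightarrow> real \<Rightarrow> nat \<Rightarrow> nat \<Rightarrow> real"
  where "transition M X t a b = measure (M a) {\<omega> \<in> space (M a). X t \<omega> = b}"

locale irreducible_reversible_chain = markov_chain n M X
  for n :: nat and M :: "nat \<Rightarrow> 'w measure" and X :: "real \<Rightarrow> 'w \<Rightarrow> nat" +
  fixes \<nu> :: "nat \<Rightarrow> real"
  assumes irreducible:
      "a \<in> {1..n} \<Longrightarrow> b \<in> {1..n} \<Longrightarrow> \<exists>t\<ge>0. transition M X t a b > 0"
    and nonneg: "a \<in> {1..n} \<Longrightarrow> 0 \<le> \<nu> a"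
    and total: "(\<Sum>a\<in>{1..n}. \<nu> a) = 1"
    and invariant:
      "b \<in> {1..n} \<Longrightarrow> 0 \<le> t \<Longrightarrow> (\<Sum>a\<in>{1..n}. \<nu> a * transition M X t a b) = \<nu> b"
    and reversible:
      "a \<in> {1..n} \<Longrightarrow> b \<in> {1..n} \<Longrightarrow> 0 \<le> t \<Longrightarrow>
       \<nu> a * transition M X t a b = \<nu> b * transition M X t b a"

definition L2_inv_norm :: "nat \<Rightarrow> (nat \<Rightarrow> real) \<Rightarrow> (nat \<Rightarrow> real) \<Rightarrow> real"
  where "L2_inv_norm n \<nu> p = sqrt (\<Sum>i\<in>{1..n}. (p i)\<^sup>2 * inverse (\<nu> i))"

definition sq_dist :: "nat \<Rightarrow> (nat \<Rightarrow> real) \<Rightarrow> (real \<Rightarrow> nat \<Rightarrow> nat \<Rightarrow> real) \<Rightarrow> real \<Rightarrow> nat \<Rightarrow> nat \<Rightarrow> real"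
  where "sq_dist n \<nu> P t a b = (L2_inv_norm n \<nu> (\<lambda>i. P t a i - P t b i))\<^sup>2"

text \<open>
  Every unordered pair of states is counted once, whence the factor \<open>1/2\<close> in front of the sum over
  ordered pairs: at \<open>t = 0\<close> the sum over ordered pairs equals \<open>2 * (n - 1)\<close>, so that only the sum
  over unordered pairs takes its values between \<open>0\<close> and \<open>n - 1\<close>.
\<close>

definition mean_sq_dist :: "nat \<Rightarrow> (nat \<Rightarrow> real) \<Rightarrow> (real \<Rightarrow> nat \<Rightarrow> nat \<Rightarrow> real) \<Rightarrow> real \<Rightarrow> real"
  where "mean_sq_dist n \<nu> P t =
    1 / 2 * (\<Sum>(a, b)\<in>{1..n} \<times> {1..n}. \<nu> a * \<nu> b * sq_dist n \<nu> P t a b)"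

text \<open>
  An orthonormal family of \<open>n\<close> joint eigenvectors of the matrices \<open>D\<^sup>1\<^sup>/\<^sup>2 P\<^sub>t D\<^sup>-\<^sup>1\<^sup>/\<^sup>2\<close>, hence a basis.
  If eigenvalues coincide it is not unique.
\<close>

definition joint_eigenbasis ::
  "nat \<Rightarrow> (nat \<Rightarrow> real) \<Rightarrow> (real \<Rightarrow> nat \<Rightarrow> nat \<Rightarrow> real) \<Rightarrow> (nat \<Rightarrow> real) \<Rightarrow> (nat \<Rightarrow> nat \<Rightarrow> real) \<Rightarrow> bool"
  where "joint_eigenbasis n \<nu> P lam v \<longleftrightarrow>
    (\<forall>k\<in>{1..n}. \<forall>l\<in>{1..n}. (\<Sum>i\<in>{1..n}. v k i * v l i) = (if k = l then 1 else 0)) \<and>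
    (\<forall>l\<in>{1..n}. \<forall>t\<ge>0. \<forall>i\<in>{1..n}.
       (\<Sum>j\<in>{1..n}. (sqrt (\<nu> i) * P t i j / sqrt (\<nu> j)) * v l j) = exp (- lam l * t) * v l i) \<and>
    lam 1 = 0 \<and> (\<forall>l\<in>{2..n}. 0 < lam l) \<and> mono_on {2..n} lam"

text \<open>The equation \<open>D\<^sup>-\<^sup>1\<^sup>/\<^sup>2 (e\<^sub>a - e\<^sub>b) = \<Sum>l=2..n. \<mu>\<^sub>l v\<^sub>l\<close> in coordinates.\<close>

definition expansion_coeffs ::
  "nat \<Rightarrow> (nat \<Rightarrow> real) \<Rightarrow> (nat \<Rightarrow> nat \<Rightarrow> real) \<Rightarrow> nat \<Rightarrow> nat \<Rightarrow> (nat \<Rightarrow> real) \<Rightarrow> bool"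
  where "expansion_coeffs n \<nu> v a b \<mu> \<longleftrightarrow>
    (\<forall>i\<in>{1..n}. ((if i = a then 1 else 0) - (if i = b then 1 else 0)) / sqrt (\<nu> i) =
       (\<Sum>l\<in>{2..n}. \<mu> l * v l i))"

definition nbhd_L :: "nat \<Rightarrow> real \<Rightarrow> real set"
  where "nbhd_L n \<delta> =
    (\<Union>k\<in>{0..<n}. {(if k = 0 then 0 else real k - \<delta>)..(if k = n - 1 then real k else real k + \<delta>)})"

text \<open>
  The intervals are indexed by \<open>k = 1, \<dots>, n\<close>, the \<open>k\<close>-th one surrounding \<open>\<Sum>l=2..k. \<mu>\<^sub>l\<^sup>2\<close>; for
  \<open>n = 1\<close> the set is \<open>{0}\<close>.
\<close>

definition nbhd :: "nat \<Rightarrow> (nat \<Rightarrow> real) \<Rightarrow> real \<Rightarrow> real set"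
  where "nbhd n \<mu> \<delta> =
    (\<Union>k\<in>{1..n}.
      {(if k = 1 then 0 else (\<Sum>l\<in>{2..k - 1}. (\<mu> l)\<^sup>2) + (1 - \<delta>) * (\<mu> k)\<^sup>2)..
       (\<Sum>l\<in>{2..k}. (\<mu> l)\<^sup>2) + (if k = n then 0 else \<delta> * (\<mu> (k + 1))\<^sup>2)})"

text \<open>The measure of a set of times with respect to \<open>dt / t\<close>; it may be infinite.\<close>

definition log_time :: "real set \<Rightarrow> ennreal"
  where "log_time T = (\<integral>\<^sup>+t\<in>{0..}. indicator T t * ennreal (1 / t) \<partial>lborel)"

end

theory Submission imports Defs
begin

text \<open>
  Both quantities have the form \<open>f t = \<Sum>l. w\<^sub>l e\<^sub>l\<close> with \<open>e\<^sub>l = exp (- 2 \<lambda>\<^sub>l t)\<close>: for the distance of two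
  starting states \<open>w\<^sub>l = \<mu>\<^sub>l\<^sup>2\<close>, and for the mean, which is the squared Hilbert-Schmidt norm of
  \<open>D\<^sup>1\<^sup>/\<^sup>2 P\<^sub>t D\<^sup>-\<^sup>1\<^sup>/\<^sup>2\<close> minus \<open>1\<close>, \<open>w\<^sub>l = 1\<close>. As a function of \<open>ln t\<close> it decreases at rate at least
  \<open>\<Sum>l. w\<^sub>l e\<^sub>l (1 - e\<^sub>l)\<close>. While \<open>f\<close> crosses the gap of length \<open>(1 - 2 \<delta>) w\<^sub>k\<close> between two consecutive
  intervals of the neighborhood, this rate is at least \<open>\<delta> w\<^sub>k / 4\<close>, so each of the \<open>n - 1\<close> gaps
  takes logarithmic time at most \<open>4 / \<delta>\<close>.

  For the mean no common eigenbasis is given. An orthonormal eigenbasis of the matrix at time \<open>1\<close> is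
  one for all dyadic times by positive semidefiniteness, and the squared norms of the images of its
  members are nonincreasing in time, which determines them at all positive times. This needs no
  continuity of the semigroup.
\<close>

subsection \<open>Level sets of sums of powers\<close>

lemma has_real_derivative_powr_const_base:
  fixes r t :: real
  assumes "0 \<le> r"
  shows "((\<lambda>t. r powr t) has_real_derivative ln r * r powr t) (at t)"
proof (cases "r = 0")
  case False
  then show ?thesis
    using assms by (auto simp: powr_def intro!: derivative_eq_intros)
qed simp

text \<open>This is ln u \<le> u - 1 at u = \<open>r powr t\<close>, multiplied by u. The left side
  is the derivative of \<open>r powr t\<close> with respect to ln t.\<close>

lemma ln_mult_powr_le:
  fixes r t :: real
  assumes "0 \<le> r" "r \<le> 1" "0 < t"
  shows "t * (ln r * r powr t) \<le> - (r powr t * (1 - r powr t))"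
proof (cases "r = 0")
  case False
  then have "t * ln r = ln (r powr t)" "0 < r powr t"
    using assms by (auto simp: ln_powr)
  moreover from this have "ln (r powr t) \<le> r powr t - 1"
    using ln_le_minus_one by blast
  ultimately have "r powr t * (t * ln r) \<le> r powr t * (r powr t - 1)"
    by simp
  then show ?thesis by (simp add: algebra_simps)
qed simp

lemma powr_antimono_exponent:
  fixes r s t :: real
  assumes "0 \<le> r" "r \<le> 1" "s \<le> t"
  shows "r powr t \<le> r powr s"
  using assms powr_mono'[of s t r] by simp

section \<open>Sets of bounded logarithmic time\<close>

lemma log_time_Icc_le:
  assumes "0 < p" "p \<le> q"
  shows "log_time {p..q} \<le> ennreal (ln q - ln p)"
proof -
  have "log_time {p..q} = (\<integral>\<^sup>+t. ennreal (1 / t) * indicator {p..q} t \<partial>lborel)"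
    unfolding log_time_def using assms
    by (intro nn_integral_cong) (auto simp: indicator_def)
  also have "\<dots> = ennreal (ln q - ln p)"
  proof (rule nn_integral_FTC_Icc)
    show "(ln has_real_derivative 1 / t) (at t)" if "t \<in> {p..q}" for t
      using that assms by (intro DERIV_ln_divide) auto
  qed (use assms in auto)
  finally show ?thesis by simp
qed

lemma log_time_zero_Un_UN_Icc_le:
  assumes "finite J" "\<And>k. k \<in> J \<Longrightarrow> 0 < p k \<and> p k \<le> q k \<and> ln (q k) - ln (p k) \<le> L"
    and "S \<subseteq> {0} \<union> (\<Union>k\<in>J. {p k..q k})"
  shows "log_time S \<le> ennreal (real (card J) * L)"
proof -
  have "log_time S \<le> (\<integral>\<^sup>+t. (\<Sum>k\<in>J. indicator {p k..q k} t * ennreal (1 / t) * indicator {0..} t) \<partial>lborel)"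
    unfolding log_time_def
  proof (rule nn_integral_mono)
    fix t :: real
    show "indicator S t * ennreal (1 / t) * indicator {0..} t
      \<le> (\<Sum>k\<in>J. indicator {p k..q k} t * ennreal (1 / t) * indicator {0..} t)"
    \<comment> \<open>At t = 0 the left side vanishes because \<open>1 / 0 = 0\<close>.\<close>
    proof (cases "t \<in> S \<and> t \<noteq> 0")
      case True
      then obtain k where k: "k \<in> J" "t \<in> {p k..q k}"
        using assms(3) by auto
      have "indicator S t * ennreal (1 / t) * indicator {0..} t
        \<le> indicator {p k..q k} t * ennreal (1 / t) * indicator {0..} t"
        using k True by simp
      also have "\<dots> \<le> (\<Sum>k\<in>J. indicator {p k..q k} t * ennreal (1 / t) * indicator {0..} t)"
        using k assms(1) by (intro member_le_sum) auto
      finally show ?thesis .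
    qed auto
  qed
  also have "\<dots> = (\<Sum>k\<in>J. log_time {p k..q k})"
    unfolding log_time_def by (subst nn_integral_sum) auto
  also have "\<dots> \<le> (\<Sum>k\<in>J. ennreal L)"
    using assms(2) by (intro sum_mono order.trans[OF log_time_Icc_le] ennreal_leI) auto
  also have "\<dots> \<le> ennreal (real (card J) * L)"
  \<comment> \<open>A member of \<open>J\<close> forces \<open>0 \<le> L\<close>, which is needed to
    turn the product of extended reals into a real one.\<close>
  proof (cases "J = {}")
    case False
    then obtain k where k: "k \<in> J" by auto
    have "ln (p k) \<le> ln (q k)"
      using assms(2)[OF k] by (intro ln_mono) auto
    then have "0 \<le> L" using assms(2)[OF k] by linarith
    then show ?thesis by (simp add: ennreal_mult ennreal_of_nat_eq_real_of_nat)
  qed auto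
  finally show ?thesis .
qed

text \<open>The interval is [p, p e^L] with p the infimum of \<open>S\<close>. Any two elements have
  ratio at most e^L, so for a fixed z in \<open>S\<close> the infimum is at least z e^(-L), hence
  positive.\<close>

lemma log_bounded_imp_subset_Icc:
  fixes S :: "real set"
  assumes "\<And>x. x \<in> S \<Longrightarrow> 0 < x" and "\<And>x y. x \<in> S \<Longrightarrow> y \<in> S \<Longrightarrow> x \<le> y \<Longrightarrow> ln y - ln x \<le> L"
    and "0 \<le> L"
  shows "\<exists>p q. 0 < p \<and> p \<le> q \<and> ln q - ln p \<le> L \<and> S \<subseteq> {p..q}"
proof (cases "S = {}")
  case True
  then show ?thesis using assms(3) by (intro exI[of _ 1]) auto
next
  case False
  then obtain z where z: "z \<in> S" by auto
  have ratio: "y \<le> x * exp L" if "x \<in> S" "y \<in> S" for x y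
  proof (cases "x \<le> y")
    case True
    then have "exp (ln y) \<le> exp (ln x + L)"
      using assms(2)[OF that] by simp
    then show ?thesis using assms(1) that by (simp add: exp_add)
  next
    case f: False
    have "y \<le> x * 1" using f by simp
    also have "\<dots> \<le> x * exp L" using assms(1,3) that by (intro mult_left_mono) (auto simp: less_imp_le)
    finally show ?thesis .
  qed
  define p where "p = Inf S"
  have low: "z * exp (- L) \<le> x" if "x \<in> S" for x
    using ratio[OF that z] by (simp add: exp_minus field_simps)
  then have bdd: "bdd_below S" by (auto simp: bdd_below_def)
  have "z * exp (- L) \<le> p"
    unfolding p_def using False low by (intro cInf_greatest) auto
  moreover have "0 < z * exp (- L)" using assms(1)[OF z] by simp
  ultimately have p: "0 < p" by linarith
  have "x \<in> {p..p * exp L}" if "x \<in> S" for x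
  proof -
    have "x * exp (- L) \<le> y" if "y \<in> S" for y
      using ratio[OF that \<open>x \<in> S\<close>] by (simp add: exp_minus field_simps)
    then have "x * exp (- L) \<le> p"
      unfolding p_def using False by (intro cInf_greatest) auto
    moreover have "p \<le> x" unfolding p_def using bdd that by (rule cInf_lower[rotated])
    ultimately show ?thesis by (simp add: exp_minus field_simps)
  qed
  moreover have "ln (p * exp L) - ln p \<le> L" using p by (simp add: ln_mult)
  moreover have "p * 1 \<le> p * exp L" using p assms(3) by (intro mult_left_mono) auto
  ultimately show ?thesis using p by (intro exI[of _ p] exI[of _ "p * exp L"]) auto
qed

text \<open>
  With \<open>e\<^sub>l = r\<^sub>l powr t\<close>, the derivative of \<open>\<Sum>l. w\<^sub>l e\<^sub>l\<close> with respect to \<open>ln t\<close> is at most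
  \<open>- (\<Sum>l. w\<^sub>l e\<^sub>l (1 - e\<^sub>l))\<close>, so if the latter sum is at least \<open>c\<close> on the set, the function plus
  \<open>c ln t\<close> is nonincreasing there. Bases equal to \<open>0\<close> stand for infinite decay rates.
\<close>

lemma powr_sum_level_set_subset_Icc:
  fixes J :: "'i set" and w r :: "'i \<Rightarrow> real"
  defines "f \<equiv> \<lambda>t. \<Sum>l\<in>J. w l * r l powr t"
  assumes w: "\<And>l. l \<in> J \<Longrightarrow> 0 \<le> w l"
    and r: "\<And>l. l \<in> J \<Longrightarrow> 0 \<le> r l \<and> r l \<le> 1"
    and c: "0 < c" and len: "\<beta> - \<alpha> \<le> c * L" "0 \<le> L"
    and steep: "\<And>t. 0 < t \<Longrightarrow> \<alpha> < f t \<Longrightarrow> f t < \<beta> \<Longrightarrow>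
      c \<le> (\<Sum>l\<in>J. w l * (r l powr t * (1 - r l powr t)))"
  shows "\<exists>p q. 0 < p \<and> p \<le> q \<and> ln q - ln p \<le> L \<and> {t. 0 < t \<and> \<alpha> < f t \<and> f t < \<beta>} \<subseteq> {p..q}"
proof (rule log_bounded_imp_subset_Icc)
  fix x y assume xy: "x \<in> {t. 0 < t \<and> \<alpha> < f t \<and> f t < \<beta>}"
    "y \<in> {t. 0 < t \<and> \<alpha> < f t \<and> f t < \<beta>}" "x \<le> y"
  have anti: "f t \<le> f s" if "s \<le> t" for s t
    unfolding f_def using w r that by (intro sum_mono mult_left_mono powr_antimono_exponent) auto
  have "f y + c * ln y \<le> f x + c * ln x"
  proof (rule DERIV_nonpos_imp_nonincreasing[OF xy(3)])
    fix t assume t: "x \<le> t" "t \<le> y"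
    \<comment> \<open>Since \<open>f\<close> is nonincreasing, every time between two times of the
      level set belongs to it, so the rate bound holds on the whole of [x, y].\<close>
    then have "0 < t" "\<alpha> < f t" "f t < \<beta>"
      using xy anti[of x t] anti[of t y] by auto
    define D where "D = (\<Sum>l\<in>J. w l * (ln (r l) * r l powr t)) + c * (1 / t)"
    have "((\<lambda>t. f t + c * ln t) has_real_derivative D) (at t)"
      unfolding f_def D_def using r \<open>0 < t\<close>
      by (intro DERIV_add DERIV_sum DERIV_cmult has_real_derivative_powr_const_base
          DERIV_ln_divide) auto
    \<comment> \<open>The factor t converts the derivative in t into the derivative in ln t.\<close>
    moreover have "D * t \<le> 0"
    proof -
      have "D * t = (\<Sum>l\<in>J. w l * (t * (ln (r l) * r l powr t))) + c"
        unfolding D_def using \<open>0 < t\<close> by (simp add: algebra_simps sum_distrib_left)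
      also have "\<dots> \<le> (\<Sum>l\<in>J. w l * - (r l powr t * (1 - r l powr t))) + c"
        using w r \<open>0 < t\<close> by (intro add_right_mono sum_mono mult_left_mono ln_mult_powr_le) auto
      also have "\<dots> \<le> 0"
        using steep[OF \<open>0 < t\<close> \<open>\<alpha> < f t\<close> \<open>f t < \<beta>\<close>] by (simp add: sum_negf)
      finally show ?thesis .
    qed
    then have "D \<le> 0" using \<open>0 < t\<close> by (simp add: mult_le_0_iff)
    ultimately show "\<exists>D. ((\<lambda>t. f t + c * ln t) has_real_derivative D) (at t) \<and> D \<le> 0" by blast
  qed
  then have "c * (ln y - ln x) \<le> c * L"
    using xy len by (auto simp: algebra_simps)
  then show "ln y - ln x \<le> L" using c by simp
qed (use len in auto)

text \<open>If the sum were smaller, rounding every \<open>e\<^sub>l\<close> would move the total by less than \<open>\<delta>\<close>.\<close>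

lemma sum_between_integers_steep:
  fixes e :: "'i \<Rightarrow> real"
  assumes "finite J" "\<And>l. l \<in> J \<Longrightarrow> 0 \<le> e l \<and> e l \<le> 1"
    and k: "real k + \<delta> < (\<Sum>l\<in>J. e l)" "(\<Sum>l\<in>J. e l) < real k + 1 - \<delta>"
  shows "\<delta> / 2 \<le> (\<Sum>l\<in>J. 1 * (e l * (1 - e l)))"
proof (rule ccontr)
  assume "\<not> ?thesis"
  then have small: "(\<Sum>l\<in>J. 2 * (e l * (1 - e l))) < \<delta>"
    by (simp add: sum_distrib_left[symmetric])
  \<comment> \<open>The cardinality of \<open>A\<close> is the total after rounding each
    \<open>e l\<close> to 0 or 1.\<close>
  define A where "A = {l\<in>J. 1 / 2 \<le> e l}"
  have "real (card A) = (\<Sum>l\<in>J. if 1 / 2 \<le> e l then 1 else 0)"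
    unfolding A_def using assms(1) by (simp add: sum.If_cases Int_def)
  then have "\<bar>(\<Sum>l\<in>J. e l) - real (card A)\<bar> = \<bar>\<Sum>l\<in>J. e l - (if 1 / 2 \<le> e l then 1 else 0)\<bar>"
    by (simp add: sum_subtractf)
  also have "\<dots> \<le> (\<Sum>l\<in>J. \<bar>e l - (if 1 / 2 \<le> e l then 1 else 0)\<bar>)"
    by (rule sum_abs)
  also have "\<dots> \<le> (\<Sum>l\<in>J. 2 * (e l * (1 - e l)))"
  proof (rule sum_mono)
    fix l assume "l \<in> J"
    then have e: "0 \<le> e l" "e l \<le> 1" using assms(2) by auto
    \<comment> \<open>The rounding error is the smaller of \<open>e l\<close> and
      \<open>1 - e l\<close>, and the larger of the two is at least 1/2.\<close>
    show "\<bar>e l - (if 1 / 2 \<le> e l then 1 else 0)\<bar> \<le> 2 * (e l * (1 - e l))"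
    proof (cases "1 / 2 \<le> e l")
      case True
      have "1 * (1 - e l) \<le> (2 * e l) * (1 - e l)"
        using True e by (intro mult_right_mono) auto
      then show ?thesis using True e by simp
    next
      case False
      have "e l * 1 \<le> e l * (2 * (1 - e l))"
        using False e by (intro mult_left_mono) auto
      then have "e l \<le> 2 * (e l * (1 - e l))" by (simp add: algebra_simps)
      then show ?thesis using False e by simp
    qed
  qed
  also note small
  finally have d: "\<bar>(\<Sum>l\<in>J. e l) - real (card A)\<bar> < \<delta>" .
  \<comment> \<open>An integer within \<delta> of the total would lie strictly between k and k +
    1.\<close>
  then have "real k < real (card A)" "real (card A) < real (Suc k)"
    using k by (auto simp: abs_less_iff)
  then show False unfolding of_nat_less_iff by simp
qed

text \<open>If \<open>e k\<close> is away from 0 and 1, its own term suffices. If \<open>e k\<close>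
  is near 0, so are at most 1/2 all later \<open>e l\<close>, while the terms from k on must supply
  at least \<open>\<delta> * w k\<close>. If \<open>e k\<close> is near 1, all earlier
  \<open>e l\<close> are at least 1/2, while the earlier terms must fall short of their weights by
  at least \<open>\<delta> / 2 * w k\<close>. In both extreme cases u \<le> 2 u (1 - u) for u in
  [0, 1/2], applied to \<open>e l\<close> or to \<open>1 - e l\<close>, finishes.\<close>

lemma powr_sum_gap_steep:
  fixes w e :: "nat \<Rightarrow> real"
  assumes \<delta>: "0 < \<delta>" "\<delta> < 1 / 2" and k: "k \<in> {2..n}"
    and w: "\<And>l. l \<in> {2..n} \<Longrightarrow> 0 \<le> w l"
    and e: "\<And>l. l \<in> {2..n} \<Longrightarrow> 0 \<le> e l \<and> e l \<le> 1"
    and anti: "\<And>l m. l \<in> {2..n} \<Longrightarrow> m \<in> {2..n} \<Longrightarrow> l \<le> m \<Longrightarrow> e m \<le> e l"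
    and low: "(\<Sum>l\<in>{2..k - 1}. w l) + \<delta> * w k < (\<Sum>l\<in>{2..n}. w l * e l)"
    and high: "(\<Sum>l\<in>{2..n}. w l * e l) < (\<Sum>l\<in>{2..k - 1}. w l) + (1 - \<delta>) * w k"
  shows "\<delta> / 4 * w k \<le> (\<Sum>l\<in>{2..n}. w l * (e l * (1 - e l)))"
proof -
  let ?g = "\<lambda>l. w l * (e l * (1 - e l))"
  have g: "0 \<le> ?g l" if "l \<in> {2..n}" for l
    using w e that by simp
  have split: "{2..n} = {2..k - 1} \<union> {k..n}" "{2..k - 1} \<inter> {k..n} = {}" "{2..k - 1} \<subseteq> {2..n}"
    "{k..n} \<subseteq> {2..n}"
    using k by auto
  have sum_split: "(\<Sum>l\<in>{2..n}. h l) = (\<Sum>l\<in>{2..k - 1}. h l) + (\<Sum>l\<in>{k..n}. h l)" for h :: "nat \<Rightarrow> real"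
    using split by (subst split(1), subst sum.union_disjoint) auto
  have wk: "0 \<le> w k" and ek: "0 \<le> e k" "e k \<le> 1" using w e k by auto
  have c: "\<delta> / 4 \<le> \<delta> / 2 * (1 - \<delta> / 2)"
  proof -
    have "\<delta> / 2 * (1 / 2) \<le> \<delta> / 2 * (1 - \<delta> / 2)" using \<delta> by (intro mult_left_mono) auto
    then show ?thesis by simp
  qed
  consider "e k < \<delta> / 2" | "1 - \<delta> / 2 < e k" | "\<delta> / 2 \<le> e k" "e k \<le> 1 - \<delta> / 2" by linarith
  then show ?thesis
  proof cases
    case 1
    have small: "e l \<le> 1 / 2" if "l \<in> {k..n}" for l
      using anti[of k l] k that 1 \<delta> by auto
    \<comment> \<open>The terms before k contribute at most their weights; the excess in
      \<open>low\<close> is due to the terms from k on.\<close>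
    have "(\<Sum>l\<in>{2..k - 1}. w l * e l) \<le> (\<Sum>l\<in>{2..k - 1}. w l)"
      using w e split(3) by (intro sum_mono mult_left_le) (auto simp: subset_iff)
    then have "\<delta> * w k \<le> (\<Sum>l\<in>{k..n}. w l * e l)"
      using low sum_split[of "\<lambda>l. w l * e l"] by linarith
    also have "\<dots> \<le> (\<Sum>l\<in>{k..n}. 2 * ?g l)"
    proof (rule sum_mono)
      fix l assume l: "l \<in> {k..n}"
      have "w l * e l * 1 \<le> w l * e l * (2 * (1 - e l))"
        using small[OF l] w e l split(4) by (intro mult_left_mono) auto
      then show "w l * e l \<le> 2 * ?g l" by (simp add: algebra_simps)
    qed
    also have "\<dots> = 2 * (\<Sum>l\<in>{k..n}. ?g l)" by (simp add: sum_distrib_left)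
    also have "\<dots> \<le> 2 * (\<Sum>l\<in>{2..n}. ?g l)"
      using g split by (intro mult_left_mono sum_mono2) auto
    finally have "\<delta> * w k \<le> 2 * (\<Sum>l\<in>{2..n}. ?g l)" .
    moreover have "0 \<le> (\<Sum>l\<in>{2..n}. ?g l)" using g by (rule sum_nonneg)
    ultimately have "\<delta> * w k \<le> 4 * (\<Sum>l\<in>{2..n}. ?g l)" by linarith
    then show ?thesis by simp
  next
    case 2
    have large: "1 / 2 \<le> e l" if "l \<in> {2..k - 1}" for l
      using anti[of l k] k that 2 \<delta> by force
    \<comment> \<open>The k-th term alone is at least \<open>(1 - \<delta> / 2) * w k\<close>;
      comparison with \<open>high\<close> leaves the deficit to the earlier terms.\<close>
    have "w k * e k \<le> (\<Sum>l\<in>{k..n}. w l * e l)"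
      using k w e by (intro member_le_sum) auto
    moreover have "(1 - \<delta> / 2) * w k \<le> w k * e k"
      using 2 wk by (subst mult.commute) (intro mult_left_mono, auto)
    ultimately have "\<delta> / 2 * w k \<le> (\<Sum>l\<in>{2..k - 1}. w l) - (\<Sum>l\<in>{2..k - 1}. w l * e l)"
      using high sum_split[of "\<lambda>l. w l * e l"] by (simp add: algebra_simps)
    also have "\<dots> = (\<Sum>l\<in>{2..k - 1}. w l * (1 - e l))"
      by (simp add: algebra_simps sum_subtractf)
    also have "\<dots> \<le> (\<Sum>l\<in>{2..k - 1}. 2 * ?g l)"
    proof (rule sum_mono)
      fix l assume l: "l \<in> {2..k - 1}"
      have "w l * (1 - e l) * 1 \<le> w l * (1 - e l) * (2 * e l)"
        using large[OF l] w e l split(3) by (intro mult_left_mono mult_nonneg_nonneg) auto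
      then show "w l * (1 - e l) \<le> 2 * ?g l" by (simp add: algebra_simps)
    qed
    also have "\<dots> = 2 * (\<Sum>l\<in>{2..k - 1}. ?g l)" by (simp add: sum_distrib_left)
    also have "\<dots> \<le> 2 * (\<Sum>l\<in>{2..n}. ?g l)"
      using g split by (intro mult_left_mono sum_mono2) auto
    finally show ?thesis by simp
  next
    case 3
    \<comment> \<open>Expanded, this says that the concave function u (1 - u) is smallest on
      [\<delta>/2, 1 - \<delta>/2] at the endpoints.\<close>
    have "0 \<le> (e k - \<delta> / 2) * (1 - \<delta> / 2 - e k)"
      using 3 by (intro mult_nonneg_nonneg) auto
    then have "\<delta> / 2 * (1 - \<delta> / 2) \<le> e k * (1 - e k)"
      by (simp add: algebra_simps)
    then have "\<delta> / 4 * w k \<le> ?g k"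
      using c wk by (subst mult.commute) (intro mult_left_mono, auto)
    also have "\<dots> \<le> (\<Sum>l\<in>{2..n}. ?g l)"
      using g k by (intro member_le_sum) auto
    finally show ?thesis .
  qed
qed

text \<open>With k the integer part of x, avoiding the intervals around k and k + 1 gives the two
  inequalities.\<close>

lemma not_in_nbhd_L:
  assumes "x \<notin> nbhd_L n \<delta>" "0 \<le> x" "x \<le> real (n - 1)" "0 < n" "0 \<le> \<delta>"
  shows "\<exists>k\<in>{0..<n - 1}. real k + \<delta> < x \<and> x < real k + 1 - \<delta>"
proof -
  have out: "\<not> ((if j = 0 then 0 else real j - \<delta>) \<le> x \<and> x \<le> (if j = n - 1 then real j else real j + \<delta>))"
    if "j < n" for j
    using assms(1) that unfolding nbhd_L_def by fastforce
  define k where "k = nat \<lfloor>x\<rfloor>"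
  have k: "real k \<le> x" "x < real k + 1"
    using assms(2) unfolding k_def by linarith+
  then have "k \<le> n - 1" using assms(3) by linarith
  \<comment> \<open>Otherwise x would equal \<open>n - 1\<close>, the right endpoint of the last
    interval.\<close>
  moreover have "k \<noteq> n - 1"
    using out[of k] k assms(3-5) by (auto split: if_splits)
  ultimately have kn: "k < n - 1" by simp
  then have "k < n" "Suc k < n" "real k + 2 \<le> real n" by simp_all
  have "real k + \<delta> < x"
    using out[OF \<open>k < n\<close>] k kn assms(2,5) by (cases "k = 0") simp_all
  moreover have "x < real k + 1 - \<delta>"
    using out[OF \<open>Suc k < n\<close>] k assms(5) \<open>real k + 2 \<le> real n\<close> by (simp split: if_splits)
  ultimately show ?thesis using kn by auto
qed

text \<open>Choose the first interval whose right endpoint is at least x. As x is not in it, x lies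
  below its left endpoint, and by minimality x lies above the right endpoint of the preceding
  interval.\<close>

lemma not_in_nbhd:
  assumes "x \<notin> nbhd n \<mu> \<delta>" "0 \<le> x" "x \<le> (\<Sum>l\<in>{2..n}. (\<mu> l)\<^sup>2)" "0 < n"
  shows "\<exists>k\<in>{2..n}. (\<Sum>l\<in>{2..k - 1}. (\<mu> l)\<^sup>2) + \<delta> * (\<mu> k)\<^sup>2 < x \<and>
    x < (\<Sum>l\<in>{2..k - 1}. (\<mu> l)\<^sup>2) + (1 - \<delta>) * (\<mu> k)\<^sup>2"
proof -
  define lo where "lo k = (if k = 1 then 0 else (\<Sum>l\<in>{2..k - 1}. (\<mu> l)\<^sup>2) + (1 - \<delta>) * (\<mu> k)\<^sup>2)" for k
  define hi where "hi k = (\<Sum>l\<in>{2..k}. (\<mu> l)\<^sup>2) + (if k = n then 0 else \<delta> * (\<mu> (k + 1))\<^sup>2)" for k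
  define k where "k = (LEAST k. 1 \<le> k \<and> x \<le> hi k)"
  have hi_n: "1 \<le> n \<and> x \<le> hi n" using assms(3,4) by (auto simp: hi_def)
  have k: "1 \<le> k \<and> x \<le> hi k" unfolding k_def by (rule LeastI[of _ n]) (rule hi_n)
  have kn: "k \<le> n" unfolding k_def by (rule Least_le) (rule hi_n)
  have xlo: "x < lo k"
    using assms(1) k kn unfolding nbhd_def lo_def hi_def by fastforce
  then have "k \<noteq> 1" using assms(2) by (auto simp: lo_def)
  with k have k2: "2 \<le> k" by simp
  have "\<not> (1 \<le> k - 1 \<and> x \<le> hi (k - 1))"
    using not_less_Least[of "k - 1" "\<lambda>k. 1 \<le> k \<and> x \<le> hi k"] k2 unfolding k_def[symmetric] by simp
  then have "hi (k - 1) < x" using k2 by linarith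
  moreover obtain m where "k = Suc m" using k2 by (cases k) auto
  ultimately show ?thesis
    using xlo k2 kn by (intro bexI[of _ k]) (auto simp: hi_def lo_def)
qed

text \<open>With equal weights the rounding argument takes the place of an ordering of the bases, so
  \<open>J\<close> may be any index set of the right size.\<close>

lemma log_time_unit_powr_sum_notin_nbhd_L:
  fixes r :: "'i \<Rightarrow> real"
  assumes \<delta>: "0 < \<delta>" "\<delta> < 1 / 2" and J: "finite J" "card J = n - 1" and n: "0 < n"
    and r: "\<And>l. l \<in> J \<Longrightarrow> 0 \<le> r l \<and> r l \<le> 1"
    and f: "\<And>t. 0 < t \<Longrightarrow> f t = (\<Sum>l\<in>J. r l powr t)"
  shows "log_time {t. 0 \<le> t \<and> f t \<notin> nbhd_L n \<delta>} \<le> ennreal (4 / \<delta> * real n)"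
proof -
  \<comment> \<open>The factors \<open>1 *\<close> bring the sum into the weighted form of
    \<open>powr_sum_level_set_subset_Icc\<close>.\<close>
  define S where "S k = {t. 0 < t \<and> real k + \<delta> < (\<Sum>l\<in>J. 1 * r l powr t) \<and>
    (\<Sum>l\<in>J. 1 * r l powr t) < real k + 1 - \<delta>}" for k
  have "\<exists>p q. 0 < p \<and> p \<le> q \<and> ln q - ln p \<le> 4 / \<delta> \<and> S k \<subseteq> {p..q}" for k
    unfolding S_def
  \<comment> \<open>The gap has length \<open>1 - 2 * \<delta>\<close>, so at rate \<delta>/2 even
    2/\<delta> would suffice; 4/\<delta> is the bound shared with the weighted case.\<close>
  proof (rule powr_sum_level_set_subset_Icc[where c = "\<delta> / 2"])
    fix t assume "0 < t" "real k + \<delta> < (\<Sum>l\<in>J. 1 * r l powr t)"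
      "(\<Sum>l\<in>J. 1 * r l powr t) < real k + 1 - \<delta>"
    then show "\<delta> / 2 \<le> (\<Sum>l\<in>J. 1 * (r l powr t * (1 - r l powr t)))"
      using J r by (intro sum_between_integers_steep) (auto intro!: powr_le1)
  qed (use r \<delta> in auto)
  then obtain p q where pq: "\<And>k. 0 < p k \<and> p k \<le> q k \<and> ln (q k) - ln (p k) \<le> 4 / \<delta> \<and> S k \<subseteq> {p k..q k}"
    by metis
  have "{t. 0 \<le> t \<and> f t \<notin> nbhd_L n \<delta>} \<subseteq> {0} \<union> (\<Union>k\<in>{0..<n - 1}. S k)"
  proof
    fix t assume t: "t \<in> {t. 0 \<le> t \<and> f t \<notin> nbhd_L n \<delta>}"
    show "t \<in> {0} \<union> (\<Union>k\<in>{0..<n - 1}. S k)"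
    \<comment> \<open>The formula for \<open>f\<close> is available at positive times only; the time
      0 is covered by the separate singleton.\<close>
    proof (cases "t = 0")
      case False
      with t have "0 < t" by simp
      have "(\<Sum>l\<in>J. r l powr t) \<le> (\<Sum>l\<in>J. 1)"
        using r \<open>0 < t\<close> by (intro sum_mono powr_le1) auto
      then have "0 \<le> f t" "f t \<le> real (n - 1)"
        using J f[OF \<open>0 < t\<close>] by (auto intro: sum_nonneg)
      then show ?thesis
        using not_in_nbhd_L[of "f t" n \<delta>] t n \<delta> f[OF \<open>0 < t\<close>] \<open>0 < t\<close> by (auto simp: S_def)
    qed simp
  qed
  also have "\<dots> \<subseteq> {0} \<union> (\<Union>k\<in>{0..<n - 1}. {p k..q k})"
    using pq by blast
  finally have "log_time {t. 0 \<le> t \<and> f t \<notin> nbhd_L n \<delta>} \<le> ennreal (real (card {0..<n - 1}) * (4 / \<delta>))"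
    using pq by (intro log_time_zero_Un_UN_Icc_le) auto
  also have "\<dots> \<le> ennreal (4 / \<delta> * real n)"
    using \<delta> by (intro ennreal_leI) (auto simp: field_simps)
  finally show ?thesis .
qed

lemma log_time_powr_sum_notin_nbhd:
  fixes r \<mu> :: "nat \<Rightarrow> real"
  assumes \<delta>: "0 < \<delta>" "\<delta> < 1 / 2" and n: "0 < n"
    and r: "\<And>l. l \<in> {2..n} \<Longrightarrow> 0 \<le> r l \<and> r l \<le> 1"
    and anti: "\<And>l m. l \<in> {2..n} \<Longrightarrow> m \<in> {2..n} \<Longrightarrow> l \<le> m \<Longrightarrow> r m \<le> r l"
    and f: "\<And>t. 0 < t \<Longrightarrow> f t = (\<Sum>l\<in>{2..n}. (\<mu> l)\<^sup>2 * r l powr t)"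
  shows "log_time {t. 0 \<le> t \<and> f t \<notin> nbhd n \<mu> \<delta>} \<le> ennreal (4 / \<delta> * real n)"
proof -
  define w where "w l = (\<mu> l)\<^sup>2" for l
  define lo where "lo k = (\<Sum>l\<in>{2..k - 1}. w l) + \<delta> * w k" for k
  define hi where "hi k = (\<Sum>l\<in>{2..k - 1}. w l) + (1 - \<delta>) * w k" for k
  define S where "S k = {t. 0 < t \<and> lo k < (\<Sum>l\<in>{2..n}. w l * r l powr t) \<and>
    (\<Sum>l\<in>{2..n}. w l * r l powr t) < hi k}" for k
  have w: "0 \<le> w l" for l by (simp add: w_def)
  have "\<exists>p q. 0 < p \<and> p \<le> q \<and> ln q - ln p \<le> 4 / \<delta> \<and> S k \<subseteq> {p..q}" if k: "k \<in> {2..n}" for k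
  \<comment> \<open>A vanishing weight gives no positive rate \<open>c\<close>, but its gap is empty
    and the interval [1, 1] serves.\<close>
  proof (cases "w k = 0")
    case True
    then have "S k = {}" by (auto simp: S_def lo_def hi_def)
    then show ?thesis using \<delta> by (intro exI[of _ 1]) auto
  next
    case False
    with w[of k] have wk: "0 < w k" by simp
    show ?thesis
      unfolding S_def
    proof (rule powr_sum_level_set_subset_Icc[where c = "\<delta> / 4 * w k"])
      fix t assume t: "0 < t" "lo k < (\<Sum>l\<in>{2..n}. w l * r l powr t)"
        "(\<Sum>l\<in>{2..n}. w l * r l powr t) < hi k"
      then show "\<delta> / 4 * w k \<le> (\<Sum>l\<in>{2..n}. w l * (r l powr t * (1 - r l powr t)))"
        unfolding lo_def hi_def using \<delta> k r w anti
        by (intro powr_sum_gap_steep) (auto intro!: powr_le1 powr_mono2)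
    next
      \<comment> \<open>Origin of 4/\<delta>: a gap of length at most \<open>w k\<close> is crossed
        at rate at least \<open>\<delta> / 4 * w k\<close>.\<close>
      have "hi k - lo k = (1 - 2 * \<delta>) * w k" by (simp add: hi_def lo_def algebra_simps)
      also have "\<dots> \<le> 1 * w k" using wk \<delta> by (intro mult_right_mono) auto
      finally show "hi k - lo k \<le> \<delta> / 4 * w k * (4 / \<delta>)" using \<delta> by simp
    qed (use r w wk \<delta> in auto)
  qed
  then obtain p q where
    pq: "\<And>k. k \<in> {2..n} \<Longrightarrow> 0 < p k \<and> p k \<le> q k \<and> ln (q k) - ln (p k) \<le> 4 / \<delta> \<and> S k \<subseteq> {p k..q k}"
    by metis
  have "{t. 0 \<le> t \<and> f t \<notin> nbhd n \<mu> \<delta>} \<subseteq> {0} \<union> (\<Union>k\<in>{2..n}. S k)"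
  proof
    fix t assume t: "t \<in> {t. 0 \<le> t \<and> f t \<notin> nbhd n \<mu> \<delta>}"
    show "t \<in> {0} \<union> (\<Union>k\<in>{2..n}. S k)"
    proof (cases "t = 0")
      case False
      with t have "0 < t" by simp
      have "(\<Sum>l\<in>{2..n}. w l * r l powr t) \<le> (\<Sum>l\<in>{2..n}. w l)"
        using r \<open>0 < t\<close> w by (intro sum_mono mult_left_le powr_le1) auto
      then have "0 \<le> f t" "f t \<le> (\<Sum>l\<in>{2..n}. (\<mu> l)\<^sup>2)"
        using f[OF \<open>0 < t\<close>] by (auto simp: w_def intro: sum_nonneg)
      then show ?thesis
        using not_in_nbhd[of "f t" n \<mu> \<delta>] t n f[OF \<open>0 < t\<close>] \<open>0 < t\<close>
        by (auto simp: S_def lo_def hi_def w_def)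
    qed simp
  qed
  also have "\<dots> \<subseteq> {0} \<union> (\<Union>k\<in>{2..n}. {p k..q k})"
    using pq by blast
  finally have "log_time {t. 0 \<le> t \<and> f t \<notin> nbhd n \<mu> \<delta>} \<le> ennreal (real (card {2..n}) * (4 / \<delta>))"
    using pq by (intro log_time_zero_Un_UN_Icc_le) auto
  also have "\<dots> \<le> ennreal (4 / \<delta> * real n)"
    using \<delta> by (intro ennreal_leI) (auto simp: field_simps)
  finally show ?thesis .
qed

subsection \<open>Symmetric matrices over a finite index set\<close>

text \<open>Vectors are functions whose values off the index set are ignored, since the dimension
  varies with the chain and is not fixed by a type.\<close>

definition ip :: "'i set \<Rightarrow> ('i \<Rightarrow> real) \<Rightarrow> ('i \<Rightarrow> real) \<Rightarrow> real"
  where "ip I x y = (\<Sum>i\<in>I. x i * y i)"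

definition mat_vec :: "'i set \<Rightarrow> ('i \<Rightarrow> 'i \<Rightarrow> real) \<Rightarrow> ('i \<Rightarrow> real) \<Rightarrow> 'i \<Rightarrow> real"
  where "mat_vec I A x i = (\<Sum>j\<in>I. A i j * x j)"

definition orthonormal_family :: "'i set \<Rightarrow> nat \<Rightarrow> (nat \<Rightarrow> 'i \<Rightarrow> real) \<Rightarrow> bool"
  where "orthonormal_family I k v \<longleftrightarrow> (\<forall>l<k. \<forall>m<k. ip I (v l) (v m) = (if l = m then 1 else 0))"

text \<open>For an orthonormal family and j in the index set, this is the component of the j-th unit
  vector orthogonal to the span of the first k members.\<close>

definition coord_residual :: "nat \<Rightarrow> (nat \<Rightarrow> 'i \<Rightarrow> real) \<Rightarrow> 'i \<Rightarrow> 'i \<Rightarrow> real"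
  where "coord_residual k v j i = (if i = j then 1 else 0) - (\<Sum>l<k. v l j * v l i)"

lemma ip_commute: "ip I x y = ip I y x"
  by (simp add: ip_def mult.commute)

lemma ip_nonneg: "0 \<le> ip I x x"
  by (auto simp: ip_def intro: sum_nonneg)

lemma ip_add_left: "ip I (\<lambda>i. x i + y i) z = ip I x z + ip I y z"
  by (simp add: ip_def algebra_simps sum.distrib)

lemma ip_add_right: "ip I z (\<lambda>i. x i + y i) = ip I z x + ip I z y"
  by (simp add: ip_def algebra_simps sum.distrib)

lemma ip_diff_right: "ip I z (\<lambda>i. x i - y i) = ip I z x - ip I z y"
  by (simp add: ip_def algebra_simps sum_subtractf)

lemma ip_scale_left: "ip I (\<lambda>i. c * x i) z = c * ip I x z"
  by (simp add: ip_def sum_distrib_left mult.assoc)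

lemma ip_scale_right: "ip I z (\<lambda>i. c * x i) = c * ip I z x"
  by (simp add: ip_def sum_distrib_left mult.left_commute)

lemma ip_sum_right: "ip I z (\<lambda>i. \<Sum>l\<in>L. x l i) = (\<Sum>l\<in>L. ip I z (x l))"
  unfolding ip_def sum_distrib_left by (rule sum.swap)

lemma ip_cong: "(\<And>i. i \<in> I \<Longrightarrow> x i = x' i) \<Longrightarrow> (\<And>i. i \<in> I \<Longrightarrow> y i = y' i) \<Longrightarrow> ip I x y = ip I x' y'"
  by (simp add: ip_def)

lemma ip_self_eq_0_iff: "finite I \<Longrightarrow> ip I x x = 0 \<longleftrightarrow> (\<forall>i\<in>I. x i = 0)"
  by (auto simp: ip_def sum_nonneg_eq_0_iff)

lemma mat_vec_cong: "(\<And>i. i \<in> I \<Longrightarrow> x i = y i) \<Longrightarrow> mat_vec I A x = mat_vec I A y"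
  by (simp add: mat_vec_def fun_eq_iff)

lemma mat_vec_add: "mat_vec I A (\<lambda>i. x i + y i) = (\<lambda>i. mat_vec I A x i + mat_vec I A y i)"
  by (simp add: mat_vec_def algebra_simps sum.distrib fun_eq_iff)

lemma mat_vec_diff: "mat_vec I A (\<lambda>i. x i - y i) = (\<lambda>i. mat_vec I A x i - mat_vec I A y i)"
  by (simp add: mat_vec_def algebra_simps sum_subtractf fun_eq_iff)

lemma mat_vec_scale: "mat_vec I A (\<lambda>i. c * x i) = (\<lambda>i. c * mat_vec I A x i)"
  by (simp add: mat_vec_def sum_distrib_left mult.left_commute fun_eq_iff)

lemma ip_mat_vec_symmetric:
  assumes "\<And>i j. i \<in> I \<Longrightarrow> j \<in> I \<Longrightarrow> A i j = A j i"
  shows "ip I x (mat_vec I A y) = ip I (mat_vec I A x) y"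
proof -
  have "ip I x (mat_vec I A y) = (\<Sum>i\<in>I. \<Sum>j\<in>I. x i * (A i j * y j))"
    by (simp add: ip_def mat_vec_def sum_distrib_left)
  also have "\<dots> = (\<Sum>j\<in>I. \<Sum>i\<in>I. x i * (A i j * y j))" by (rule sum.swap)
  also have "\<dots> = (\<Sum>j\<in>I. \<Sum>i\<in>I. A j i * x i * y j)"
    using assms by (intro sum.cong) (auto simp: mult_ac)
  also have "\<dots> = ip I (mat_vec I A x) y"
    by (simp add: ip_def mat_vec_def sum_distrib_right)
  finally show ?thesis .
qed

lemma sum_mult_indicator_eq:
  fixes f :: "'i \<Rightarrow> real"
  assumes "finite I" "j \<in> I"
  shows "(\<Sum>i\<in>I. f i * (if i = j then 1 else 0)) = f j"
  using assms by (simp add: if_distrib[of "\<lambda>z. f _ * z"] cong: if_cong)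

lemma ip_coord_residual:
  assumes "finite I" "orthonormal_family I k v" "l < k" "j \<in> I"
  shows "ip I (v l) (coord_residual k v j) = 0"
proof -
  have "ip I (v l) (coord_residual k v j)
    = (\<Sum>i\<in>I. v l i * (if i = j then 1 else 0)) - (\<Sum>m<k. v m j * ip I (v l) (v m))"
    unfolding coord_residual_def ip_diff_right ip_sum_right ip_scale_right by (simp add: ip_def)
  also have "(\<Sum>i\<in>I. v l i * (if i = j then 1 else 0)) = v l j"
    using assms(1,4) by (rule sum_mult_indicator_eq)
  also have "(\<Sum>m<k. v m j * ip I (v l) (v m)) = (\<Sum>m<k. if m = l then v l j else 0)"
    using assms(2,3) by (intro sum.cong) (auto simp: orthonormal_family_def)
  also have "\<dots> = v l j" using assms(3) by simp
  finally show ?thesis by simp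
qed

lemma ip_coord_residual_self:
  assumes "finite I" "orthonormal_family I k v" "j \<in> I"
  shows "ip I (coord_residual k v j) (coord_residual k v j) = 1 - (\<Sum>l<k. (v l j)\<^sup>2)"
proof -
  let ?x = "coord_residual k v j"
  \<comment> \<open>Only the second factor is unfolded: its projection part is orthogonal to the
    residual, leaving the j-th coordinate.\<close>
  have "ip I ?x ?x = ip I ?x (\<lambda>i. (if i = j then 1 else 0) - (\<Sum>l<k. v l j * v l i))"
    by (simp add: coord_residual_def ip_def)
  also have "\<dots> = (\<Sum>i\<in>I. ?x i * (if i = j then 1 else 0)) - (\<Sum>m<k. v m j * ip I (v m) ?x)"
    unfolding ip_diff_right ip_sum_right ip_scale_right ip_commute[of I ?x] by (simp add: ip_def mult.commute)
  also have "\<dots> = ?x j"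
    using assms by (simp add: ip_coord_residual sum_mult_indicator_eq)
  finally show ?thesis by (simp add: coord_residual_def power2_eq_square)
qed

text \<open>A dimension count: the left side is the trace of the orthogonal projection onto the
  complement of the span.\<close>

lemma sum_ip_coord_residual:
  assumes "finite I" "orthonormal_family I k v"
  shows "(\<Sum>j\<in>I. ip I (coord_residual k v j) (coord_residual k v j)) = real (card I) - real k"
proof -
  have "(\<Sum>j\<in>I. ip I (coord_residual k v j) (coord_residual k v j)) = real (card I) - (\<Sum>j\<in>I. \<Sum>l<k. (v l j)\<^sup>2)"
    using assms by (simp add: ip_coord_residual_self sum_subtractf)
  also have "(\<Sum>j\<in>I. \<Sum>l<k. (v l j)\<^sup>2) = (\<Sum>l<k. ip I (v l) (v l))"
    by (subst sum.swap) (simp add: ip_def power2_eq_square)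
  also have "\<dots> = real k" using assms(2) by (simp add: orthonormal_family_def)
  finally show ?thesis .
qed

text \<open>For a family of full size the residuals have total squared length 0, so each of them
  vanishes.\<close>

lemma orthonormal_family_complete:
  assumes "finite I" "orthonormal_family I (card I) v" "i \<in> I" "j \<in> I"
  shows "(\<Sum>l<card I. v l j * v l i) = (if i = j then 1 else 0)"
proof -
  have "\<forall>j\<in>I. ip I (coord_residual (card I) v j) (coord_residual (card I) v j) = 0"
    using sum_ip_coord_residual[OF assms(1,2)] assms(1)
    by (subst sum_nonneg_eq_0_iff[symmetric]) (auto intro: ip_nonneg)
  then show ?thesis
    using assms by (auto simp: ip_self_eq_0_iff coord_residual_def)
qed

section \<open>Orthonormal eigenvectors by maximization of the quadratic form\<close>

lemma exists_unit_orthogonal: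
  assumes "finite I" "orthonormal_family I k v" "k < card I"
  shows "\<exists>x. (\<forall>i. i \<notin> I \<longrightarrow> x i = 0) \<and> ip I x x = 1 \<and> (\<forall>l<k. ip I (v l) x = 0)"
proof -
  \<comment> \<open>The squared lengths of the residuals sum to \<open>card I - k\<close>, which is
    positive, so some residual can be normalized.\<close>
  have "\<exists>j\<in>I. 0 < ip I (coord_residual k v j) (coord_residual k v j)"
  proof (rule ccontr)
    assume "\<not> ?thesis"
    then have "(\<Sum>j\<in>I. ip I (coord_residual k v j) (coord_residual k v j)) \<le> 0"
      by (intro sum_nonpos) auto
    then show False using sum_ip_coord_residual[OF assms(1,2)] assms(3) by simp
  qed
  then obtain j where j: "j \<in> I" "0 < ip I (coord_residual k v j) (coord_residual k v j)" by auto
  define s where "s = ip I (coord_residual k v j) (coord_residual k v j)"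
  define x where "x i = (if i \<in> I then 1 / sqrt s * coord_residual k v j i else 0)" for i
  have ip_x: "ip I y x = 1 / sqrt s * ip I y (coord_residual k v j)" for y
    unfolding ip_scale_right[symmetric] by (rule ip_cong) (auto simp: x_def)
  have "ip I x x = 1 / sqrt s * (1 / sqrt s * s)"
    unfolding s_def ip_x ip_commute[of I x "coord_residual k v j"] by (simp add: s_def)
  then have "ip I x x = 1" using j by (simp add: s_def[symmetric])
  moreover have "\<forall>l<k. ip I (v l) x = 0"
    using assms j by (simp add: ip_x ip_coord_residual)
  ultimately show ?thesis by (intro exI[of _ x]) (auto simp: x_def)
qed

text \<open>The topology is the product topology on all functions. Fixing the values off
  \<open>I\<close> to 0 places the sphere in a product of compact factors, [-1, 1] and {0}, where it
  is closed.\<close>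

lemma compact_unit_sphere_orthogonal:
  assumes "finite I"
  shows "compact {x. (\<forall>i. i \<notin> I \<longrightarrow> x i = 0) \<and> ip I x x = 1 \<and> (\<forall>l<k. ip I (v l) x = 0)}"
    (is "compact ?K")
proof -
  let ?C = "PiE UNIV (\<lambda>i. if i \<in> I then {-1..1} else {0::real})"
  have "compactin (product_topology (\<lambda>_. euclidean) UNIV) ?C"
    by (subst compactin_PiE) auto
  then have "compact ?C" by (simp add: euclidean_product_topology)
  moreover have "closed ?K"
    unfolding ip_def
    by (intro closed_Collect_conj closed_Collect_all closed_Collect_imp closed_Collect_eq
        continuous_intros open_Collect_const) auto
  moreover have "?K \<subseteq> ?C"
  proof
    fix x assume x: "x \<in> ?K"
    have "x i \<in> {-1..1}" if "i \<in> I" for i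
    proof -
      have "x i * x i \<le> (\<Sum>i\<in>I. x i * x i)"
        using assms that by (intro member_le_sum) auto
      then have "(x i)\<^sup>2 \<le> 1\<^sup>2" using x by (simp add: ip_def power2_eq_square)
      then have "\<bar>x i\<bar> \<le> 1" by (subst (asm) abs_le_square_iff[symmetric]) simp
      then show ?thesis by auto
    qed
    then show "x \<in> ?C" using x by auto
  qed
  ultimately show ?thesis using compact_Int_closed[of ?C ?K] by (simp add: Int_absorb1)
qed

text \<open>A unit vector \<open>x\<close> maximizing the quadratic form of \<open>A\<close> on the
  orthogonal complement is an eigenvector. The form \<open>B\<close> is nonnegative on the
  complement and 0 at \<open>x\<close>, so its first variation at \<open>x\<close> in the direction
  \<open>A x - \<beta> x\<close> must vanish.\<close>

lemma eigenvector_orthogonal_to_eigenvectors: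
  assumes "finite I" and sym: "\<And>i j. i \<in> I \<Longrightarrow> j \<in> I \<Longrightarrow> A i j = A j i"
    and v: "orthonormal_family I k v" "k < card I"
    and ev: "\<And>l i. l < k \<Longrightarrow> i \<in> I \<Longrightarrow> mat_vec I A (v l) i = \<alpha> l * v l i"
  shows "\<exists>x \<beta>. ip I x x = 1 \<and> (\<forall>l<k. ip I (v l) x = 0) \<and> (\<forall>i\<in>I. mat_vec I A x i = \<beta> * x i)"
proof -
  let ?K = "{x. (\<forall>i. i \<notin> I \<longrightarrow> x i = 0) \<and> ip I x x = 1 \<and> (\<forall>l<k. ip I (v l) x = 0)}"
  have "\<exists>x\<in>?K. \<forall>y\<in>?K. ip I y (mat_vec I A y) \<le> ip I x (mat_vec I A x)"
  proof (rule continuous_attains_sup)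
    show "continuous_on ?K (\<lambda>x. ip I x (mat_vec I A x))"
      unfolding ip_def mat_vec_def
      by (intro continuous_intros continuous_on_subset[OF continuous_on_product_coordinates]) auto
  qed (use compact_unit_sphere_orthogonal[OF assms(1)] exists_unit_orthogonal[OF assms(1) v] in auto)
  then obtain x where x: "x \<in> ?K" and max: "\<And>y. y \<in> ?K \<Longrightarrow> ip I y (mat_vec I A y) \<le> ip I x (mat_vec I A x)"
    by blast
  define \<beta> where "\<beta> = ip I x (mat_vec I A x)"
  define B where "B y = \<beta> * ip I y y - ip I y (mat_vec I A y)" for y
  \<comment> \<open>By homogeneity the maximality on unit vectors extends to the whole
    complement.\<close>
  have B_nonneg: "0 \<le> B y" if y: "\<And>l. l < k \<Longrightarrow> ip I (v l) y = 0" for y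
  proof (cases "ip I y y = 0")
    case True
    then have "\<forall>i\<in>I. y i = 0" by (simp add: ip_self_eq_0_iff assms(1))
    then have "ip I y (mat_vec I A y) = 0" by (simp add: ip_def)
    with True show ?thesis by (simp add: B_def)
  next
    case False
    with ip_nonneg[of I y] have s: "0 < ip I y y" by simp
    define c where "c = 1 / sqrt (ip I y y)"
    define z where "z i = (if i \<in> I then c * y i else 0)" for i
    have z: "ip I u z = c * ip I u y" "mat_vec I A z = (\<lambda>i. c * mat_vec I A y i)" for u
    proof -
      show "ip I u z = c * ip I u y"
        unfolding ip_scale_right[symmetric] by (rule ip_cong) (auto simp: z_def)
      show "mat_vec I A z = (\<lambda>i. c * mat_vec I A y i)"
        unfolding mat_vec_scale[symmetric] by (rule mat_vec_cong) (auto simp: z_def)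
    qed
    have c: "c * c * ip I y y = 1" "0 < c" using s by (auto simp: c_def)
    have "ip I z z = 1"
      unfolding z(1)[of z] ip_commute[of I z y] z(1)[of y] using c by (simp add: mult.assoc)
    moreover have "\<forall>i. i \<notin> I \<longrightarrow> z i = 0" by (simp add: z_def)
    ultimately have "z \<in> ?K" using y z(1) by simp
    then have "ip I z (mat_vec I A z) \<le> \<beta>" unfolding \<beta>_def by (rule max)
    moreover have "ip I z (mat_vec I A z) = c * (c * ip I (mat_vec I A y) y)"
      unfolding z(2) ip_scale_right ip_commute[of I z] z(1) ..
    ultimately have "c * c * ip I y (mat_vec I A y) \<le> \<beta>"
      by (simp add: ip_commute[of I y] mult.assoc)
    also have "\<beta> = c * c * (\<beta> * ip I y y)" using c(1) by (simp add: mult.left_commute)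
    finally have "c * c * ip I y (mat_vec I A y) \<le> c * c * (\<beta> * ip I y y)" .
    then show ?thesis using c(2) by (simp add: B_def)
  qed
  define z where "z i = mat_vec I A x i - \<beta> * x i" for i
  \<comment> \<open>The complement is invariant because \<open>A\<close> is symmetric and each
    \<open>v l\<close> is an eigenvector.\<close>
  have z_orth: "ip I (v l) z = 0" if "l < k" for l
  proof -
    have "ip I (v l) (mat_vec I A x) = ip I (mat_vec I A (v l)) x" by (rule ip_mat_vec_symmetric) (rule sym)
    also have "\<dots> = ip I (\<lambda>i. \<alpha> l * v l i) x" using ev[OF that] by (intro ip_cong) auto
    also have "\<dots> = 0" using x that by (simp add: ip_scale_left)
    finally show ?thesis using x that
      unfolding z_def[abs_def] by (simp add: ip_diff_right ip_scale_right)
  qed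
  have Bx: "B x = 0" using x by (simp add: B_def \<beta>_def)
  \<comment> \<open>This is \<open>B\<close> at \<open>x + \<epsilon> z\<close>: the constant term
    vanishes and the linear one is -2 \<epsilon> times the squared norm of \<open>z\<close>.\<close>
  have quad: "0 \<le> \<epsilon> * \<epsilon> * B z - 2 * \<epsilon> * ip I z z" for \<epsilon>
  proof -
    have zz: "ip I z z = ip I z (mat_vec I A x) - \<beta> * ip I z x"
      unfolding ip_scale_right[symmetric] ip_diff_right[symmetric] by (simp add: z_def[abs_def])
    have sz: "ip I x (mat_vec I A z) = ip I z (mat_vec I A x)"
      by (subst ip_mat_vec_symmetric) (auto simp: ip_commute sym)
    have "0 \<le> B (\<lambda>i. x i + \<epsilon> * z i)"
      using x z_orth by (intro B_nonneg) (simp add: ip_add_right ip_scale_right)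
    also have "\<dots> = B x + 2 * \<epsilon> * (\<beta> * ip I z x - ip I z (mat_vec I A x)) + \<epsilon> * \<epsilon> * B z"
      unfolding B_def mat_vec_add mat_vec_scale ip_add_left ip_add_right ip_scale_left ip_scale_right sz
        ip_commute[of I x z]
      by (simp only: ring_distribs mult_ac add_ac)
    also have "\<beta> * ip I z x - ip I z (mat_vec I A x) = - ip I z z" using zz by simp
    finally show ?thesis using Bx by simp
  qed
  have "ip I z z = 0"
  proof (rule ccontr)
    assume "ip I z z \<noteq> 0"
    with ip_nonneg[of I z] have s: "0 < ip I z z" by simp
    have b: "0 \<le> B z" using z_orth by (rule B_nonneg)
    \<comment> \<open>This makes \<open>\<epsilon> * B z\<close> smaller than the squared norm of
      \<open>z\<close>, so the linear term dominates; the summand 1 keeps the denominator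
      positive.\<close>
    define \<epsilon> where "\<epsilon> = ip I z z / (B z + 1)"
    have \<epsilon>: "0 < \<epsilon>" "\<epsilon> * (B z + 1) = ip I z z" using s b by (auto simp: \<epsilon>_def)
    have "0 \<le> \<epsilon> * (\<epsilon> * B z - 2 * ip I z z)"
      using quad[of \<epsilon>] by (simp add: algebra_simps)
    then have "0 \<le> \<epsilon> * B z - 2 * ip I z z" using \<epsilon>(1) by (simp add: zero_le_mult_iff)
    then show False using \<epsilon> s by (simp add: algebra_simps)
  qed
  then have "\<forall>i\<in>I. mat_vec I A x i = \<beta> * x i"
    using assms(1) by (auto simp: ip_self_eq_0_iff z_def)
  then show ?thesis using x by blast
qed

lemma symmetric_matrix_orthonormal_eigenbasis:
  assumes "finite I" and sym: "\<And>i j. i \<in> I \<Longrightarrow> j \<in> I \<Longrightarrow> A i j = A j i"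
  shows "\<exists>v \<alpha>. orthonormal_family I (card I) v \<and> (\<forall>l<card I. \<forall>i\<in>I. mat_vec I A (v l) i = \<alpha> l * v l i)"
proof -
  have "\<exists>v \<alpha>. orthonormal_family I k v \<and> (\<forall>l<k. \<forall>i\<in>I. mat_vec I A (v l) i = \<alpha> l * v l i)"
    if "k \<le> card I" for k
    using that
  proof (induction k)
    case 0
    show ?case by (auto simp: orthonormal_family_def)
  next
    case (Suc k)
    then obtain v \<alpha> where v: "orthonormal_family I k v"
      and ev: "\<And>l i. l < k \<Longrightarrow> i \<in> I \<Longrightarrow> mat_vec I A (v l) i = \<alpha> l * v l i"
      by auto
    obtain x \<beta> where x: "ip I x x = 1" "\<And>l. l < k \<Longrightarrow> ip I (v l) x = 0"
      "\<And>i. i \<in> I \<Longrightarrow> mat_vec I A x i = \<beta> * x i"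
      using eigenvector_orthogonal_to_eigenvectors[OF assms v _ ev] Suc.prems by auto
    have "ip I x (v l) = 0" if "l < k" for l
      using x(2)[OF that] by (simp add: ip_commute)
    then have "orthonormal_family I (Suc k) (v(k := x))"
      using v x by (auto simp: orthonormal_family_def less_Suc_eq)
    moreover have "\<forall>l<Suc k. \<forall>i\<in>I. mat_vec I A ((v(k := x)) l) i = (\<alpha>(k := \<beta>)) l * (v(k := x)) l i"
      using ev x by (auto simp: less_Suc_eq)
    ultimately show ?case by blast
  qed
  then show ?thesis by blast
qed

subsection \<open>Symmetric contraction semigroups\<close>

text \<open>The time t is squeezed between dyadics \<open>a k\<close> and \<open>b k\<close> at
  distance 2^(-k); monotonicity of \<open>f\<close> and continuity of \<open>g\<close> at t do the
  rest. The numerators \<open>Suc m\<close> keep the dyadics positive.\<close>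

lemma antimono_eq_on_positive_dyadics:
  fixes f g :: "real \<Rightarrow> real"
  assumes anti: "\<And>s t. 0 < s \<Longrightarrow> s \<le> t \<Longrightarrow> f t \<le> f s"
    and cont: "isCont g t"
    and eq: "\<And>m k. f (real (Suc m) / 2 ^ k) = g (real (Suc m) / 2 ^ k)"
    and t: "0 < t"
  shows "f t = g t"
proof -
  define m where "m k = nat \<lfloor>t * 2 ^ k\<rfloor>" for k :: nat
  define b where "b k = real (Suc (m k)) / 2 ^ k" for k
  define a where "a k = real (m k) / 2 ^ k" for k
  have m: "real (m k) \<le> t * 2 ^ k" "t * 2 ^ k < real (Suc (m k))" for k
  proof -
    have "0 \<le> \<lfloor>t * 2 ^ k\<rfloor>" using t by simp
    then have "real (m k) = of_int \<lfloor>t * 2 ^ k\<rfloor>" unfolding m_def by simp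
    then show "real (m k) \<le> t * 2 ^ k" "t * 2 ^ k < real (Suc (m k))" by linarith+
  qed
  have ab: "a k \<le> t" "t \<le> b k" "b k = a k + (1 / 2) ^ k" for k
    using m[of k] by (auto simp: a_def b_def field_simps)
  have p: "(\<lambda>k. (1 / 2) ^ k) \<longlonglongrightarrow> (0::real)" by (rule LIMSEQ_power_zero) simp
  have b_lim: "b \<longlonglongrightarrow> t"
  proof (rule tendsto_sandwich)
    show "\<forall>\<^sub>F k in sequentially. t \<le> b k" "\<forall>\<^sub>F k in sequentially. b k \<le> t + (1 / 2) ^ k"
      using ab(1,2) by (simp_all add: ab(3))
    show "(\<lambda>k. t + (1 / 2) ^ k) \<longlonglongrightarrow> t" using tendsto_add[OF tendsto_const[of t] p] by simp
  qed simp
  have a_lim: "a \<longlonglongrightarrow> t"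
    using tendsto_diff[OF b_lim p] ab(3) by simp
  show ?thesis
  proof (rule antisym)
    \<comment> \<open>For small k the lower approximation may be 0, where nothing is known, so this
      bound is used only eventually.\<close>
    have "f t \<le> g (a k)" if "0 < a k" for k
    proof -
      have "m k \<noteq> 0" using that by (intro notI) (simp add: a_def)
      then obtain j where "m k = Suc j" using not0_implies_Suc by blast
      then have "f (a k) = g (a k)" using eq[of j k] by (simp only: a_def)
      then show ?thesis using anti[OF that ab(1)] by simp
    qed
    moreover have "\<forall>\<^sub>F k in sequentially. 0 < a k"
      using order_tendstoD(1)[OF a_lim t] .
    ultimately have "\<forall>\<^sub>F k in sequentially. f t \<le> g (a k)"
      by (auto elim: eventually_mono)
    with isCont_tendsto_compose[OF cont a_lim] show "f t \<le> g t"
      by (rule tendsto_lowerbound) simp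
    have "g (b k) \<le> f t" for k
      using anti[OF t ab(2)[of k]] eq[of "m k" k] by (simp only: b_def)
    with isCont_tendsto_compose[OF cont b_lim] show "g t \<le> f t"
      by (intro tendsto_upperbound) (auto intro!: always_eventually)
  qed
qed

text \<open>All times are strictly positive. The eigenvalue 0 remains possible and corresponds to
  the base 0 of a power.\<close>

locale symmetric_contraction_semigroup =
  fixes I :: "'i set" and S :: "real \<Rightarrow> 'i \<Rightarrow> 'i \<Rightarrow> real"
  assumes fin: "finite I"
    and symmetric: "0 < t \<Longrightarrow> i \<in> I \<Longrightarrow> j \<in> I \<Longrightarrow> S t i j = S t j i"
    and semigroup: "0 < s \<Longrightarrow> 0 < t \<Longrightarrow> i \<in> I \<Longrightarrow> j \<in> I \<Longrightarrow> S (s + t) i j = (\<Sum>c\<in>I. S s i c * S t c j)"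
    and contraction: "0 < t \<Longrightarrow> ip I (mat_vec I (S t) x) (mat_vec I (S t) x) \<le> ip I x x"
begin

lemma mat_vec_semigroup:
  assumes "0 < s" "0 < t" "i \<in> I"
  shows "mat_vec I (S (s + t)) x i = mat_vec I (S s) (mat_vec I (S t) x) i"
proof -
  have "mat_vec I (S (s + t)) x i = (\<Sum>j\<in>I. \<Sum>c\<in>I. S s i c * S t c j * x j)"
    using assms by (simp add: mat_vec_def semigroup sum_distrib_right)
  also have "\<dots> = (\<Sum>c\<in>I. \<Sum>j\<in>I. S s i c * S t c j * x j)" by (rule sum.swap)
  also have "\<dots> = mat_vec I (S s) (mat_vec I (S t) x) i"
    by (simp add: mat_vec_def sum_distrib_left mult.assoc)
  finally show ?thesis .
qed

lemma ip_mat_vec_sym: "0 < t \<Longrightarrow> ip I x (mat_vec I (S t) y) = ip I (mat_vec I (S t) x) y"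
  by (rule ip_mat_vec_symmetric) (rule symmetric)

text \<open>\<open>S t\<close> is the square of the symmetric matrix \<open>S (t / 2)\<close>, hence
  positive semidefinite.\<close>

lemma ip_mat_vec_eq_half:
  assumes "0 < t"
  shows "ip I x (mat_vec I (S t) x) = ip I (mat_vec I (S (t / 2)) x) (mat_vec I (S (t / 2)) x)"
proof -
  have "ip I x (mat_vec I (S t) x) = ip I x (mat_vec I (S (t / 2)) (mat_vec I (S (t / 2)) x))"
    using mat_vec_semigroup[of "t / 2" "t / 2" _ x] assms by (intro ip_cong) auto
  then show ?thesis using assms by (simp add: ip_mat_vec_sym)
qed

text \<open>The square root of an eigenvalue is the right one because \<open>S (t / 2)\<close> is positive semidefinite.\<close>

lemma eigenvector_half:
  assumes t: "0 < t" and "0 \<le> \<beta>" and ev: "\<And>i. i \<in> I \<Longrightarrow> mat_vec I (S t) v i = \<beta> * v i"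
    and "i \<in> I"
  shows "mat_vec I (S (t / 2)) v i = sqrt \<beta> * v i"
proof -
  define u where "u i = mat_vec I (S (t / 2)) v i - sqrt \<beta> * v i" for i
  have "ip I u u = 0"
  proof (cases "\<beta> = 0")
    case True
    then have "ip I u u = ip I v (mat_vec I (S t) v)"
      using t by (simp add: u_def[abs_def] ip_mat_vec_eq_half)
    also have "\<dots> = 0" using ev True by (simp add: ip_def)
    finally show ?thesis .
  next
    case False
    \<comment> \<open>From (S(t/2) + sqrt \<beta>)(S(t/2) - sqrt \<beta>) v = 0: a nonzero
      \<open>u\<close> would be an eigenvector to a negative eigenvalue.\<close>
    have "mat_vec I (S (t / 2)) u i = - sqrt \<beta> * u i" if "i \<in> I" for i
    proof -
      have "mat_vec I (S (t / 2)) u i = mat_vec I (S t) v i - sqrt \<beta> * mat_vec I (S (t / 2)) v i"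
        using mat_vec_semigroup[of "t / 2" "t / 2" i v] t that
        unfolding u_def[abs_def] mat_vec_diff mat_vec_scale by simp
      then show ?thesis
        using ev[OF that] \<open>0 \<le> \<beta>\<close> by (simp add: u_def algebra_simps)
    qed
    then have "ip I u (mat_vec I (S (t / 2)) u) = ip I u (\<lambda>i. - sqrt \<beta> * u i)"
      by (intro ip_cong) auto
    then have "sqrt \<beta> * ip I u u = - ip I u (mat_vec I (S (t / 2)) u)"
      unfolding ip_scale_right by simp
    also have "\<dots> \<le> 0" using ip_mat_vec_eq_half[of "t / 2" u] t by (simp add: ip_nonneg)
    finally have "ip I u u \<le> 0" using False \<open>0 \<le> \<beta>\<close> by (simp add: mult_le_0_iff)
    then show ?thesis using ip_nonneg[of I u] by simp
  qed
  then show ?thesis using fin \<open>i \<in> I\<close> by (simp add: ip_self_eq_0_iff u_def)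
qed

text \<open>Halving the time k times reaches the step \<open>1 / 2 ^ k\<close>; the semigroup law
  then adds up steps.\<close>

lemma eigenvector_dyadic:
  assumes "0 \<le> \<alpha>" and ev: "\<And>i. i \<in> I \<Longrightarrow> mat_vec I (S 1) v i = \<alpha> * v i" and "i \<in> I"
  shows "mat_vec I (S (real (Suc m) / 2 ^ k)) v i = \<alpha> powr (real (Suc m) / 2 ^ k) * v i"
proof -
  have base: "mat_vec I (S (1 / 2 ^ k)) v i = \<alpha> powr (1 / 2 ^ k) * v i" if "i \<in> I" for i
    using that
  proof (induction k arbitrary: i)
    case 0
    then show ?case using ev assms(1) by simp
  next
    case (Suc k)
    have "mat_vec I (S ((1 / 2 ^ k) / 2)) v i = sqrt (\<alpha> powr (1 / 2 ^ k)) * v i"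
      using Suc by (intro eigenvector_half) auto
    moreover have "sqrt (\<alpha> powr (1 / 2 ^ k)) = \<alpha> powr (1 / 2 ^ Suc k)"
      by (simp add: powr_half_sqrt[symmetric] powr_powr mult.commute)
    ultimately show ?case by (simp add: mult.commute)
  qed
  show ?thesis
    using \<open>i \<in> I\<close>
  proof (induction m arbitrary: i)
    case 0
    then show ?case using base by simp
  next
    case (Suc m)
    let ?t = "real (Suc m) / 2 ^ k" and ?h = "1 / 2 ^ k :: real"
    have t: "real (Suc (Suc m)) / 2 ^ k = ?t + ?h" by (simp add: add_divide_distrib)
    have "mat_vec I (S (?t + ?h)) v i = mat_vec I (S ?t) (mat_vec I (S ?h) v) i"
      using Suc.prems by (intro mat_vec_semigroup) auto
    also have "mat_vec I (S ?t) (mat_vec I (S ?h) v) = mat_vec I (S ?t) (\<lambda>i. \<alpha> powr ?h * v i)"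
      using base by (rule mat_vec_cong)
    also have "\<dots> i = \<alpha> powr ?h * (\<alpha> powr ?t * v i)"
      unfolding mat_vec_scale using Suc by simp
    also have "\<dots> = \<alpha> powr (?t + ?h) * v i" by (simp add: powr_add)
    finally show ?case unfolding t .
  qed
qed

text \<open>The squared norm is nonincreasing by contraction and has the stated value at positive
  dyadic times. At other times it is found without showing that \<open>v\<close> is an
  eigenvector.\<close>

lemma norm_mat_vec_eigenvector:
  assumes \<alpha>: "0 \<le> \<alpha>" and ev: "\<And>i. i \<in> I \<Longrightarrow> mat_vec I (S 1) v i = \<alpha> * v i"
    and unit: "ip I v v = 1" and t: "0 < t"
  shows "ip I (mat_vec I (S t) v) (mat_vec I (S t) v) = (\<alpha>\<^sup>2) powr t"
proof (rule antimono_eq_on_positive_dyadics[OF _ _ _ t])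
  fix s t :: real assume st: "0 < s" "s \<le> t"
  show "ip I (mat_vec I (S t) v) (mat_vec I (S t) v) \<le> ip I (mat_vec I (S s) v) (mat_vec I (S s) v)"
  proof (cases "s = t")
    case False
    with st have st': "0 < t - s" by simp
    have "ip I (mat_vec I (S t) v) (mat_vec I (S t) v)
      = ip I (mat_vec I (S (t - s)) (mat_vec I (S s) v)) (mat_vec I (S (t - s)) (mat_vec I (S s) v))"
      using mat_vec_semigroup[OF st' st(1), of _ v] by (intro ip_cong) auto
    then show ?thesis using contraction[OF st'] by simp
  qed simp
next
  show "isCont (\<lambda>t. \<alpha>\<^sup>2 powr t) t"
    by (rule DERIV_isCont[OF has_real_derivative_powr_const_base]) simp
next
  fix m k
  let ?t = "real (Suc m) / 2 ^ k"
  have "ip I (mat_vec I (S ?t) v) (mat_vec I (S ?t) v) = ip I (\<lambda>i. \<alpha> powr ?t * v i) (\<lambda>i. \<alpha> powr ?t * v i)"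
    using eigenvector_dyadic[OF \<alpha> ev] by (intro ip_cong) auto
  also have "\<dots> = \<alpha> powr ?t * \<alpha> powr ?t"
    unfolding ip_scale_left ip_scale_right using unit by simp
  also have "\<dots> = \<alpha>\<^sup>2 powr ?t"
    using \<alpha> by (simp add: power2_eq_square powr_mult)
  finally show "ip I (mat_vec I (S ?t) v) (mat_vec I (S ?t) v) = \<alpha>\<^sup>2 powr ?t" .
qed

text \<open>The squared Hilbert-Schmidt norm is the sum of the squared norms of the images of any
  orthonormal basis; an eigenbasis at time 1 gives powers of the squared eigenvalues. The fixed
  vector \<open>w\<close> supplies the eigenvalue 1.\<close>

lemma sum_squares_spectral:
  assumes fixed: "\<And>i. i \<in> I \<Longrightarrow> mat_vec I (S 1) w i = w i" and w: "\<exists>i\<in>I. w i \<noteq> 0"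
  shows "\<exists>r l0. l0 < card I \<and> r l0 = 1 \<and> (\<forall>l<card I. 0 \<le> r l \<and> r l \<le> 1) \<and>
    (\<forall>t>0. (\<Sum>i\<in>I. \<Sum>j\<in>I. (S t i j)\<^sup>2) = (\<Sum>l<card I. r l powr t))"
proof -
  have "\<exists>v \<alpha>. orthonormal_family I (card I) v \<and> (\<forall>l<card I. \<forall>i\<in>I. mat_vec I (S 1) (v l) i = \<alpha> l * v l i)"
    by (rule symmetric_matrix_orthonormal_eigenbasis[OF fin]) (rule symmetric, simp_all)
  then obtain v \<alpha> where v: "orthonormal_family I (card I) v"
    and ev: "\<And>l i. l < card I \<Longrightarrow> i \<in> I \<Longrightarrow> mat_vec I (S 1) (v l) i = \<alpha> l * v l i"
    by blast
  have unit: "ip I (v l) (v l) = 1" if "l < card I" for l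
    using v that by (simp add: orthonormal_family_def)
  have alpha_nonneg: "0 \<le> \<alpha> l" if "l < card I" for l
  proof -
    have "\<alpha> l = ip I (v l) (\<lambda>i. \<alpha> l * v l i)" unfolding ip_scale_right by (simp add: unit that)
    also have "\<dots> = ip I (v l) (mat_vec I (S 1) (v l))" using ev that by (intro ip_cong) auto
    also have "\<dots> \<ge> 0" by (simp add: ip_mat_vec_eq_half ip_nonneg)
    finally show ?thesis .
  qed
  have alpha_le: "(\<alpha> l)\<^sup>2 \<le> 1" if "l < card I" for l
  proof -
    have "(\<alpha> l)\<^sup>2 = ip I (mat_vec I (S 1) (v l)) (mat_vec I (S 1) (v l))"
      using norm_mat_vec_eigenvector[of "\<alpha> l" "v l" 1] alpha_nonneg ev unit that by simp
    also have "\<dots> \<le> ip I (v l) (v l)" by (rule contraction) simp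
    finally show ?thesis using unit that by simp
  qed
  \<comment> \<open>By completeness of the basis, a nonzero vector cannot be orthogonal to every
    member.\<close>
  have "\<exists>l0<card I. ip I (v l0) w \<noteq> 0"
  proof (rule ccontr)
    assume "\<not> ?thesis"
    then have 0: "ip I (v l) w = 0" if "l < card I" for l using that by auto
    obtain j where j: "j \<in> I" "w j \<noteq> 0" using w by auto
    have "w j = (\<Sum>i\<in>I. w i * (if i = j then 1 else 0))"
      using fin j by (simp add: sum_mult_indicator_eq)
    also have "\<dots> = (\<Sum>i\<in>I. w i * (\<Sum>l<card I. v l j * v l i))"
      using orthonormal_family_complete[OF fin v _ j(1)] by (intro sum.cong) auto
    also have "\<dots> = (\<Sum>i\<in>I. \<Sum>l<card I. v l j * (v l i * w i))"
      by (simp add: sum_distrib_left mult_ac)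
    also have "\<dots> = (\<Sum>l<card I. \<Sum>i\<in>I. v l j * (v l i * w i))" by (rule sum.swap)
    also have "\<dots> = (\<Sum>l<card I. v l j * ip I (v l) w)" by (simp add: ip_def sum_distrib_left)
    finally show False using 0 j by simp
  qed
  then obtain l0 where l0: "l0 < card I" "ip I (v l0) w \<noteq> 0" by auto
  \<comment> \<open>Moving \<open>S 1\<close> across the inner product multiplies a nonzero number
    by \<open>\<alpha> l0\<close> without changing it.\<close>
  have "ip I (v l0) w = ip I (v l0) (mat_vec I (S 1) w)" using fixed by (intro ip_cong) auto
  also have "\<dots> = ip I (mat_vec I (S 1) (v l0)) w" by (simp add: ip_mat_vec_sym)
  also have "\<dots> = ip I (\<lambda>i. \<alpha> l0 * v l0 i) w" using ev l0 by (intro ip_cong) auto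
  finally have "\<alpha> l0 = 1" using l0 by (simp add: ip_scale_left)
  moreover have "(\<Sum>i\<in>I. \<Sum>j\<in>I. (S t i j)\<^sup>2) = (\<Sum>l<card I. (\<alpha> l)\<^sup>2 powr t)" if t: "0 < t" for t
  proof -
    have "(\<Sum>l<card I. (\<alpha> l)\<^sup>2 powr t) = (\<Sum>l<card I. ip I (mat_vec I (S t) (v l)) (mat_vec I (S t) (v l)))"
      using alpha_nonneg ev unit t by (intro sum.cong refl norm_mat_vec_eigenvector[symmetric]) auto
    also have "\<dots> = (\<Sum>l<card I. \<Sum>i\<in>I. \<Sum>j\<in>I. \<Sum>j'\<in>I. S t i j * S t i j' * (v l j * v l j'))"
      by (simp add: ip_def mat_vec_def sum_product mult_ac)
    also have "\<dots> = (\<Sum>i\<in>I. \<Sum>j\<in>I. \<Sum>j'\<in>I. \<Sum>l<card I. S t i j * S t i j' * (v l j * v l j'))"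
      by (subst sum.swap, intro sum.cong refl, subst sum.swap, intro sum.cong refl, subst sum.swap) (rule refl)
    \<comment> \<open>Completeness of the basis collapses the sum over l, leaving the diagonal j =
      j'.\<close>
    also have "\<dots> = (\<Sum>i\<in>I. \<Sum>j\<in>I. \<Sum>j'\<in>I. S t i j * S t i j' * (if j' = j then 1 else 0))"
      using orthonormal_family_complete[OF fin v] by (intro sum.cong refl) (simp flip: sum_distrib_left)
    also have "\<dots> = (\<Sum>i\<in>I. \<Sum>j\<in>I. (S t i j)\<^sup>2)"
      using fin by (simp add: sum_mult_indicator_eq power2_eq_square)
    finally show ?thesis ..
  qed
  ultimately show ?thesis
    using l0 alpha_le by (intro exI[of _ "\<lambda>l. (\<alpha> l)\<^sup>2"] exI[of _ l0]) auto
qed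

end

subsection \<open>Reversible Markov chains\<close>

context markov_chain
begin

section \<open>Transition probabilities and the Chapman-Kolmogorov equation\<close>

lemma X_event:
  assumes "a \<in> {1..n}" "0 \<le> t"
  shows "{\<omega> \<in> space (M a). X t \<omega> = b} \<in> sets (M a)"
proof (cases "b \<in> {1..n}")
  case True
  have "X t -` {b} \<inter> space (M a) \<in> sets (M a)"
    using True by (intro measurable_sets[OF measurable_X[OF assms]]) auto
  also have "X t -` {b} \<inter> space (M a) = {\<omega> \<in> space (M a). X t \<omega> = b}" by auto
  finally show ?thesis .
next
  case False
  then have "{\<omega> \<in> space (M a). X t \<omega> = b} = {}"
    using measurable_space[OF measurable_X[OF assms]] by auto
  then show ?thesis by (simp only: sets.empty_sets)
qed

lemma measure_partition_X:
  assumes a: "a \<in> {1..n}" "0 \<le> t" and E: "E \<in> sets (M a)"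
  shows "measure (M a) E = (\<Sum>c\<in>{1..n}. measure (M a) {\<omega> \<in> E. X t \<omega> = c})"
proof -
  interpret prob_space "M a" using a(1) by (rule prob_space_M)
  have in_E: "{\<omega> \<in> E. X t \<omega> = c} = E \<inter> {\<omega> \<in> space (M a). X t \<omega> = c}" for c
    using sets.sets_into_space[OF E] by auto
  have "measure (M a) (\<Union>c\<in>{1..n}. {\<omega> \<in> E. X t \<omega> = c}) = (\<Sum>c\<in>{1..n}. measure (M a) {\<omega> \<in> E. X t \<omega> = c})"
    using E X_event[OF a] unfolding in_E
    by (intro finite_measure_finite_Union) (auto simp: disjoint_family_on_def)
  also have "(\<Union>c\<in>{1..n}. {\<omega> \<in> E. X t \<omega> = c}) = E"
    using measurable_space[OF measurable_X[OF a]] sets.sets_into_space[OF E] by auto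
  finally show ?thesis .
qed

lemma transition_nonneg: "0 \<le> transition M X t a b"
  by (simp add: transition_def)

lemma sum_transition:
  assumes "a \<in> {1..n}" "0 \<le> t"
  shows "(\<Sum>b\<in>{1..n}. transition M X t a b) = 1"
proof -
  interpret prob_space "M a" using assms(1) by (rule prob_space_M)
  show ?thesis
    using measure_partition_X[OF assms sets.top] prob_space by (simp add: transition_def)
qed

lemma chapman_kolmogorov:
  assumes "a \<in> {1..n}" "b \<in> {1..n}" "0 \<le> s" "0 \<le> t"
  shows "transition M X (s + t) a b = (\<Sum>c\<in>{1..n}. transition M X s a c * transition M X t c b)"
proof -
  have "transition M X (s + t) a b
    = (\<Sum>c\<in>{1..n}. measure (M a) {\<omega> \<in> {\<omega> \<in> space (M a). X (s + t) \<omega> = b}. X s \<omega> = c})"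
    unfolding transition_def using assms by (intro measure_partition_X X_event) auto
  also have "\<dots> = (\<Sum>c\<in>{1..n}. transition M X s a c * transition M X t c b)"
  proof (rule sum.cong)
    fix c assume "c \<in> {1..n}"
    \<comment> \<open>The Markov property is used with no earlier times,
      \<open>F = {}\<close>.\<close>
    then have "measure (M a) {\<omega> \<in> space (M a). X s \<omega> = c \<and> X (s + t) \<omega> = b}
      = transition M X s a c * transition M X t c b"
      using markov_property[of a b c s t "{}"] assms by (simp add: transition_def)
    moreover have "{\<omega> \<in> {\<omega> \<in> space (M a). X (s + t) \<omega> = b}. X s \<omega> = c}
      = {\<omega> \<in> space (M a). X s \<omega> = c \<and> X (s + t) \<omega> = b}" by auto
    ultimately show "measure (M a) {\<omega> \<in> {\<omega> \<in> space (M a). X (s + t) \<omega> = b}. X s \<omega> = c}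
      = transition M X s a c * transition M X t c b" by simp
  qed simp
  finally show ?thesis .
qed

end

context irreducible_reversible_chain
begin

section \<open>The symmetrized transition matrices of a reversible chain\<close>

lemma n_pos: "0 < n"
  using total by (cases n) auto

text \<open>Some state b has positive weight and reaches a with positive probability; detailed
  balance then excludes weight 0 at a.\<close>

lemma nu_pos:
  assumes a: "a \<in> {1..n}"
  shows "0 < \<nu> a"
proof (rule ccontr)
  assume "\<not> 0 < \<nu> a"
  with nonneg[OF a] have 0: "\<nu> a = 0" by simp
  obtain b where b: "b \<in> {1..n}" "\<nu> b \<noteq> 0"
    using total by (metis sum.neutral zero_neq_one)
  obtain t where t: "0 \<le> t" "0 < transition M X t b a"
    using irreducible[OF b(1) a] by auto
  show False using reversible[OF b(1) a t(1)] 0 b(2) t(2) by simp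
qed

text \<open>The entries of \<open>D\<^sup>1\<^sup>/\<^sup>2 P\<^sub>t
  D\<^sup>-\<^sup>1\<^sup>/\<^sup>2\<close>; detailed balance makes this matrix symmetric.\<close>

definition sym_transition :: "real \<Rightarrow> nat \<Rightarrow> nat \<Rightarrow> real"
  where "sym_transition t i j = sqrt (\<nu> i) * transition M X t i j / sqrt (\<nu> j)"

lemma sym_transition_symmetric:
  assumes "0 \<le> t" "i \<in> {1..n}" "j \<in> {1..n}"
  shows "sym_transition t i j = sym_transition t j i"
proof -
  have "sqrt (\<nu> i) * sqrt (\<nu> i) = \<nu> i" "sqrt (\<nu> j) * sqrt (\<nu> j) = \<nu> j"
    using nonneg assms by auto
  then have "(sqrt (\<nu> i) * sqrt (\<nu> i)) * transition M X t i j = (sqrt (\<nu> j) * sqrt (\<nu> j)) * transition M X t j i"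
    using reversible[OF assms(2,3,1)] by simp
  then have "sqrt (\<nu> i) * transition M X t i j * sqrt (\<nu> i) = sqrt (\<nu> j) * transition M X t j i * sqrt (\<nu> j)"
    by (simp only: mult_ac)
  then show ?thesis
    using nu_pos[OF assms(2)] nu_pos[OF assms(3)] by (simp add: sym_transition_def frac_eq_eq)
qed

lemma sym_transition_semigroup:
  assumes "0 \<le> s" "0 \<le> t" "i \<in> {1..n}" "j \<in> {1..n}"
  shows "sym_transition (s + t) i j = (\<Sum>c\<in>{1..n}. sym_transition s i c * sym_transition t c j)"
proof -
  have "(\<Sum>c\<in>{1..n}. sym_transition s i c * sym_transition t c j)
    = (\<Sum>c\<in>{1..n}. sqrt (\<nu> i) * (transition M X s i c * transition M X t c j) / sqrt (\<nu> j))"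
    using nu_pos by (intro sum.cong) (auto simp: sym_transition_def less_imp_neq[THEN not_sym])
  also have "\<dots> = sym_transition (s + t) i j"
    using assms by (simp add: sym_transition_def chapman_kolmogorov sum_distrib_left sum_divide_distrib)
  finally show ?thesis ..
qed

text \<open>Jensen's inequality for the transition probabilities, integrated against \<open>\<nu>\<close>.\<close>

lemma sym_transition_contraction:
  assumes t: "0 \<le> t"
  shows "ip {1..n} (mat_vec {1..n} (sym_transition t) x) (mat_vec {1..n} (sym_transition t) x) \<le> ip {1..n} x x"
proof -
  let ?P = "transition M X t"
  define y where "y j = x j / sqrt (\<nu> j)" for j
  have jensen: "(\<Sum>j\<in>{1..n}. ?P i j * y j)\<^sup>2 \<le> (\<Sum>j\<in>{1..n}. ?P i j * (y j)\<^sup>2)" if i: "i \<in> {1..n}" for i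
  proof -
    \<comment> \<open>Splitting each probability into two square roots prepares Cauchy-Schwarz,
      whose first factor is the row sum 1.\<close>
    have "(\<Sum>j\<in>{1..n}. ?P i j * y j)\<^sup>2 = (\<Sum>j\<in>{1..n}. sqrt (?P i j) * (sqrt (?P i j) * y j))\<^sup>2"
      using transition_nonneg by (simp add: mult.assoc[symmetric])
    also have "\<dots> \<le> (\<Sum>j\<in>{1..n}. (sqrt (?P i j))\<^sup>2) * (\<Sum>j\<in>{1..n}. (sqrt (?P i j) * y j)\<^sup>2)"
      by (rule Cauchy_Schwarz_ineq_sum)
    also have "\<dots> = (\<Sum>j\<in>{1..n}. ?P i j * (y j)\<^sup>2)"
      using transition_nonneg sum_transition[OF i t] by (simp add: power_mult_distrib)
    finally show ?thesis .
  qed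
  have "ip {1..n} (mat_vec {1..n} (sym_transition t) x) (mat_vec {1..n} (sym_transition t) x)
    = (\<Sum>i\<in>{1..n}. \<nu> i * (\<Sum>j\<in>{1..n}. ?P i j * y j)\<^sup>2)"
    unfolding ip_def
  proof (rule sum.cong)
    fix i assume i: "i \<in> {1..n}"
    have "mat_vec {1..n} (sym_transition t) x i = sqrt (\<nu> i) * (\<Sum>j\<in>{1..n}. ?P i j * y j)"
      by (simp add: mat_vec_def sym_transition_def y_def sum_distrib_left mult.assoc)
    then show "mat_vec {1..n} (sym_transition t) x i * mat_vec {1..n} (sym_transition t) x i
      = \<nu> i * (\<Sum>j\<in>{1..n}. ?P i j * y j)\<^sup>2"
      using nonneg[OF i] by (simp add: power_mult_distrib flip: power2_eq_square)
  qed simp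
  also have "\<dots> \<le> (\<Sum>i\<in>{1..n}. \<nu> i * (\<Sum>j\<in>{1..n}. ?P i j * (y j)\<^sup>2))"
    using jensen nonneg by (intro sum_mono mult_left_mono) auto
  also have "\<dots> = (\<Sum>i\<in>{1..n}. \<Sum>j\<in>{1..n}. \<nu> i * ?P i j * (y j)\<^sup>2)"
    by (simp add: sum_distrib_left mult.assoc)
  also have "\<dots> = (\<Sum>j\<in>{1..n}. \<Sum>i\<in>{1..n}. \<nu> i * ?P i j * (y j)\<^sup>2)" by (rule sum.swap)
  also have "\<dots> = (\<Sum>j\<in>{1..n}. \<nu> j * (y j)\<^sup>2)"
    using invariant t by (intro sum.cong) (auto simp flip: sum_distrib_right)
  also have "\<dots> = ip {1..n} x x"
    unfolding ip_def using nu_pos nonneg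
    by (intro sum.cong) (auto simp: y_def power_divide power2_eq_square[symmetric] less_imp_neq[THEN not_sym])
  finally show ?thesis .
qed

sublocale symmetric_contraction_semigroup "{1..n}" sym_transition
  by unfold_locales
    (use sym_transition_symmetric sym_transition_semigroup sym_transition_contraction in auto)

text \<open>Since the rows of \<open>P\<^sub>t\<close> sum to 1, the square root of \<nu> is the
  fixed vector required in \<open>sum_squares_spectral\<close>.\<close>

lemma sym_transition_fixed:
  assumes t: "0 \<le> t" and i: "i \<in> {1..n}"
  shows "mat_vec {1..n} (sym_transition t) (\<lambda>j. sqrt (\<nu> j)) i = sqrt (\<nu> i)"
proof -
  have "mat_vec {1..n} (sym_transition t) (\<lambda>j. sqrt (\<nu> j)) i = (\<Sum>j\<in>{1..n}. sqrt (\<nu> i) * transition M X t i j)"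
    unfolding mat_vec_def using nu_pos
    by (intro sum.cong) (auto simp: sym_transition_def less_imp_neq[THEN not_sym])
  also have "\<dots> = sqrt (\<nu> i) * (\<Sum>j\<in>{1..n}. transition M X t i j)" by (simp add: sum_distrib_left)
  finally show ?thesis using sum_transition[OF i t] by simp
qed

section \<open>Spectral formulas for the squared distances\<close>

lemma sq_dist_eq:
  "sq_dist n \<nu> P t a b = (\<Sum>i\<in>{1..n}. (P t a i - P t b i)\<^sup>2 * inverse (\<nu> i))"
  unfolding sq_dist_def L2_inv_norm_def using nonneg by (intro real_sqrt_pow2 sum_nonneg) auto

text \<open>For each target state i the double sum is twice the variance of
  \<open>P\<^sub>t(a, i)\<close> under \<nu>, whose mean is \<open>\<nu> i\<close> by invariance.
  After division by \<open>\<nu> i\<close> and summation over i, the second moments give the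
  Hilbert-Schmidt norm and the squared means give the total mass 1.\<close>

lemma mean_sq_dist_eq:
  assumes t: "0 \<le> t"
  shows "mean_sq_dist n \<nu> (transition M X) t = (\<Sum>i\<in>{1..n}. \<Sum>j\<in>{1..n}. (sym_transition t i j)\<^sup>2) - 1"
proof -
  let ?P = "transition M X t"
  have pair: "(\<Sum>a\<in>{1..n}. \<Sum>b\<in>{1..n}. \<nu> a * \<nu> b * (?P a i - ?P b i)\<^sup>2)
    = 2 * (\<Sum>a\<in>{1..n}. \<nu> a * (?P a i)\<^sup>2) - 2 * (\<nu> i)\<^sup>2" if i: "i \<in> {1..n}" for i
  proof -
    define q where "q = (\<Sum>a\<in>{1..n}. \<nu> a * (?P a i)\<^sup>2)"
    have "(\<Sum>a\<in>{1..n}. \<Sum>b\<in>{1..n}. \<nu> a * \<nu> b * (?P a i - ?P b i)\<^sup>2)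
      = (\<Sum>a\<in>{1..n}. \<Sum>b\<in>{1..n}. \<nu> a * (?P a i)\<^sup>2 * \<nu> b + \<nu> a * (\<nu> b * (?P b i)\<^sup>2)
          - 2 * (\<nu> a * ?P a i) * (\<nu> b * ?P b i))"
      by (intro sum.cong refl) (simp add: power2_eq_square algebra_simps)
    also have "\<dots> = (\<Sum>a\<in>{1..n}. \<nu> a * (?P a i)\<^sup>2 * 1 + \<nu> a * q - 2 * (\<nu> a * ?P a i) * \<nu> i)"
      unfolding sum_subtractf sum.distrib sum_distrib_left[symmetric] total invariant[OF i t] q_def ..
    also have "\<dots> = q + q - 2 * \<nu> i * \<nu> i"
      unfolding sum_subtractf sum.distrib sum_distrib_right[symmetric] sum_distrib_left[symmetric]
        total invariant[OF i t] by (simp add: q_def)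
    finally show ?thesis by (simp add: q_def power2_eq_square)
  qed
  have "(\<Sum>(a, b)\<in>{1..n} \<times> {1..n}. \<nu> a * \<nu> b * sq_dist n \<nu> (transition M X) t a b)
    = (\<Sum>a\<in>{1..n}. \<Sum>b\<in>{1..n}. \<Sum>i\<in>{1..n}. \<nu> a * \<nu> b * (?P a i - ?P b i)\<^sup>2 * inverse (\<nu> i))"
    by (simp add: sum.cartesian_product[symmetric] sq_dist_eq sum_distrib_left mult.assoc)
  also have "\<dots> = (\<Sum>a\<in>{1..n}. \<Sum>i\<in>{1..n}. \<Sum>b\<in>{1..n}. \<nu> a * \<nu> b * (?P a i - ?P b i)\<^sup>2 * inverse (\<nu> i))"
    by (rule sum.cong[OF refl]) (rule sum.swap)
  also have "\<dots> = (\<Sum>i\<in>{1..n}. \<Sum>a\<in>{1..n}. \<Sum>b\<in>{1..n}. \<nu> a * \<nu> b * (?P a i - ?P b i)\<^sup>2 * inverse (\<nu> i))"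
    by (rule sum.swap)
  also have "\<dots> = (\<Sum>i\<in>{1..n}. (2 * (\<Sum>a\<in>{1..n}. \<nu> a * (?P a i)\<^sup>2) - 2 * (\<nu> i)\<^sup>2) * inverse (\<nu> i))"
    using pair by (intro sum.cong refl) (simp flip: sum_distrib_right)
  also have "\<dots> = (\<Sum>i\<in>{1..n}. 2 * (\<Sum>a\<in>{1..n}. (sym_transition t a i)\<^sup>2) - 2 * \<nu> i)"
  proof (rule sum.cong)
    fix i assume i: "i \<in> {1..n}"
    have "(\<Sum>a\<in>{1..n}. (sym_transition t a i)\<^sup>2) = (\<Sum>a\<in>{1..n}. \<nu> a * (?P a i)\<^sup>2) * inverse (\<nu> i)"
      unfolding sum_distrib_right using nonneg i
      by (intro sum.cong) (auto simp: sym_transition_def power_mult_distrib power_divide field_simps)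
    moreover have "(\<nu> i)\<^sup>2 * inverse (\<nu> i) = \<nu> i"
      using nu_pos[OF i] by (simp add: power2_eq_square)
    ultimately show "(2 * (\<Sum>a\<in>{1..n}. \<nu> a * (?P a i)\<^sup>2) - 2 * (\<nu> i)\<^sup>2) * inverse (\<nu> i)
      = 2 * (\<Sum>a\<in>{1..n}. (sym_transition t a i)\<^sup>2) - 2 * \<nu> i"
      by (simp add: left_diff_distrib mult.assoc)
  qed simp
  also have "\<dots> = 2 * (\<Sum>i\<in>{1..n}. \<Sum>a\<in>{1..n}. (sym_transition t a i)\<^sup>2) - 2"
    unfolding sum_subtractf sum_distrib_left[symmetric] total by simp
  also have "(\<Sum>i\<in>{1..n}. \<Sum>a\<in>{1..n}. (sym_transition t a i)\<^sup>2) = (\<Sum>a\<in>{1..n}. \<Sum>i\<in>{1..n}. (sym_transition t a i)\<^sup>2)"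
    by (rule sum.swap)
  finally show ?thesis unfolding mean_sq_dist_def by simp
qed

text \<open>The power of the base \<open>r l0 = 1\<close> is constantly 1 and cancels the subtracted
  1, leaving n - 1 terms.\<close>

lemma mean_sq_dist_spectral:
  "\<exists>J r. finite J \<and> card (J :: nat set) = n - 1 \<and> (\<forall>l\<in>J. 0 \<le> r l \<and> r l \<le> (1 :: real)) \<and>
    (\<forall>t>0. mean_sq_dist n \<nu> (transition M X) t = (\<Sum>l\<in>J. r l powr t))"
proof -
  have "\<exists>r l0. l0 < card {1..n} \<and> r l0 = 1 \<and> (\<forall>l<card {1..n}. 0 \<le> r l \<and> r l \<le> 1) \<and>
    (\<forall>t>0. (\<Sum>i\<in>{1..n}. \<Sum>j\<in>{1..n}. (sym_transition t i j)\<^sup>2) = (\<Sum>l<card {1..n}. r l powr t))"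
  proof (rule sum_squares_spectral)
    show "\<exists>i\<in>{1..n}. sqrt (\<nu> i) \<noteq> 0" using nu_pos[of 1] n_pos by (intro bexI[of _ 1]) auto
  qed (use sym_transition_fixed in auto)
  then obtain r l0 where l0: "l0 < n" "r l0 = 1" and r: "\<forall>l<n. 0 \<le> r l \<and> r l \<le> (1::real)"
    and eq: "\<And>t. 0 < t \<Longrightarrow> (\<Sum>i\<in>{1..n}. \<Sum>j\<in>{1..n}. (sym_transition t i j)\<^sup>2) = (\<Sum>l<n. r l powr t)"
    by auto
  have "mean_sq_dist n \<nu> (transition M X) t = (\<Sum>l\<in>{..<n} - {l0}. r l powr t)" if "0 < t" for t
    using l0 eq[OF that] that by (simp add: mean_sq_dist_eq sum.remove[of "{..<n}" l0])
  then show ?thesis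
    using l0 r by (intro exI[of _ "{..<n} - {l0}"] exI[of _ r]) auto
qed

text \<open>The symmetrized matrix maps
  \<open>D\<^sup>-\<^sup>1\<^sup>/\<^sup>2 (e\<^sub>a - e\<^sub>b)\<close> to the difference of the
  two laws divided by the square root of \<nu>. In the eigenbasis it multiplies the l-th coefficient
  by exp(-\<lambda> t), with \<lambda> = \<open>lam l\<close>, and orthonormality turns the norm
  into a sum of squares.\<close>

lemma sq_dist_spectral:
  assumes basis: "joint_eigenbasis n \<nu> (transition M X) lam v"
    and coeffs: "expansion_coeffs n \<nu> v a b \<mu>"
    and ab: "a \<in> {1..n}" "b \<in> {1..n}" and t: "0 \<le> t"
  shows "sq_dist n \<nu> (transition M X) t a b = (\<Sum>l\<in>{2..n}. (\<mu> l)\<^sup>2 * exp (- 2 * lam l) powr t)"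
proof -
  let ?P = "transition M X t" and ?e = "\<lambda>l. \<mu> l * exp (- lam l * t)"
  have orth: "ip {1..n} (v l) (v m) = (if l = m then 1 else 0)" if "l \<in> {2..n}" "m \<in> {2..n}" for l m
    using basis that unfolding joint_eigenbasis_def ip_def by auto
  have ev: "mat_vec {1..n} (sym_transition t) (v l) i = exp (- lam l * t) * v l i"
    if "l \<in> {2..n}" "i \<in> {1..n}" for l i
    using basis that t unfolding joint_eigenbasis_def mat_vec_def sym_transition_def by auto
  define w where "w i = (\<Sum>l\<in>{2..n}. ?e l * v l i)" for i
  have coord: "(?P a i - ?P b i) / sqrt (\<nu> i) = w i" if i: "i \<in> {1..n}" for i
  proof -
    \<comment> \<open>Applying the matrix to a scaled unit vector picks out a column; symmetry turns
      it into the row holding the law started at c.\<close>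
    have row: "?P c i / sqrt (\<nu> i) = (\<Sum>j\<in>{1..n}. sym_transition t i j * ((if j = c then 1 else 0) / sqrt (\<nu> j)))"
      if c: "c \<in> {1..n}" for c
    proof -
      have "(\<Sum>j\<in>{1..n}. sym_transition t i j * ((if j = c then 1 else 0) / sqrt (\<nu> j)))
        = (\<Sum>j\<in>{1..n}. sym_transition t i j / sqrt (\<nu> j) * (if j = c then 1 else 0))"
        by (intro sum.cong) auto
      also have "\<dots> = sym_transition t i c / sqrt (\<nu> c)"
        by (rule sum_mult_indicator_eq) (use c in auto)
      also have "\<dots> = sym_transition t c i / sqrt (\<nu> c)"
        using sym_transition_symmetric[OF t i c] by simp
      also have "\<dots> = ?P c i / sqrt (\<nu> i)"
        using nu_pos[OF c] by (simp add: sym_transition_def)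
      finally show ?thesis ..
    qed
    have "(?P a i - ?P b i) / sqrt (\<nu> i)
      = (\<Sum>j\<in>{1..n}. sym_transition t i j * (((if j = a then 1 else 0) - (if j = b then 1 else 0)) / sqrt (\<nu> j)))"
      unfolding diff_divide_distrib row[OF ab(1)] row[OF ab(2)] right_diff_distrib sum_subtractf ..
    also have "\<dots> = (\<Sum>j\<in>{1..n}. sym_transition t i j * (\<Sum>l\<in>{2..n}. \<mu> l * v l j))"
      using coeffs unfolding expansion_coeffs_def by (intro sum.cong) auto
    also have "\<dots> = (\<Sum>j\<in>{1..n}. \<Sum>l\<in>{2..n}. \<mu> l * (sym_transition t i j * v l j))"
      by (simp add: sum_distrib_left mult.left_commute)
    also have "\<dots> = (\<Sum>l\<in>{2..n}. \<mu> l * mat_vec {1..n} (sym_transition t) (v l) i)"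
      by (subst sum.swap) (simp add: mat_vec_def sum_distrib_left)
    also have "\<dots> = w i"
      unfolding w_def using ev i by (intro sum.cong) auto
    finally show ?thesis .
  qed
  have "sq_dist n \<nu> (transition M X) t a b = (\<Sum>i\<in>{1..n}. ((?P a i - ?P b i) / sqrt (\<nu> i))\<^sup>2)"
    unfolding sq_dist_eq using nonneg by (intro sum.cong) (auto simp: power_divide field_simps)
  also have "\<dots> = ip {1..n} w w"
    unfolding ip_def using coord by (intro sum.cong) (auto simp: power2_eq_square)
  also have "\<dots> = (\<Sum>l\<in>{2..n}. ?e l * (\<Sum>m\<in>{2..n}. ?e m * ip {1..n} (v l) (v m)))"
  proof -
    have expand: "ip {1..n} y w = (\<Sum>l\<in>{2..n}. ?e l * ip {1..n} y (v l))" for y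
      unfolding w_def[abs_def] ip_sum_right ip_scale_right ..
    have "ip {1..n} w (v l) = (\<Sum>m\<in>{2..n}. ?e m * ip {1..n} (v l) (v m))" for l
      by (subst ip_commute) (rule expand)
    then show ?thesis by (subst expand) (simp only:)
  qed
  also have "\<dots> = (\<Sum>l\<in>{2..n}. ?e l * (\<Sum>m\<in>{2..n}. ?e m * (if m = l then 1 else 0)))"
    using orth by (intro sum.cong refl arg_cong2[of _ _ _ _ "(*)"]) auto
  also have "\<dots> = (\<Sum>l\<in>{2..n}. ?e l * ?e l)"
    by (intro sum.cong refl arg_cong2[of _ _ _ _ "(*)"] sum_mult_indicator_eq) auto
  also have "\<dots> = (\<Sum>l\<in>{2..n}. (\<mu> l)\<^sup>2 * exp (- 2 * lam l) powr t)"
  proof -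
    have "exp (- 2 * lam l) powr t = exp (- lam l * t) * exp (- lam l * t)" for l
      by (simp add: powr_def mult.commute flip: exp_add)
    then show ?thesis by (simp add: power2_eq_square mult_ac)
  qed
  finally show ?thesis .
qed

end

section \<open>Both logarithmic time bounds with a constant independent of the chain\<close>

theorem theorem7:
  fixes \<delta> :: real
  assumes "0 < \<delta>" and "\<delta> < 1 / 2"
  shows "\<exists>K::real. K > 0 \<and>
    (\<forall>(n::nat) (M :: nat \<Rightarrow> (real \<Rightarrow> nat) measure) (X :: real \<Rightarrow> (real \<Rightarrow> nat) \<Rightarrow> nat)
      (\<nu> :: nat \<Rightarrow> real).
      irreducible_reversible_chain n M X \<nu> \<longrightarrow>
        log_time {t. 0 \<le> t \<and> mean_sq_dist n \<nu> (transition M X) t \<notin> nbhd_L n \<delta>}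
          \<le> ennreal (K * real n) \<and>
        (\<forall>(lam :: nat \<Rightarrow> real) (v :: nat \<Rightarrow> nat \<Rightarrow> real).
          joint_eigenbasis n \<nu> (transition M X) lam v \<longrightarrow>
            (\<forall>a\<in>{1..n}. \<forall>b\<in>{1..n}. \<forall>\<mu> :: nat \<Rightarrow> real.
              expansion_coeffs n \<nu> v a b \<mu> \<longrightarrow>
                log_time {t. 0 \<le> t \<and> sq_dist n \<nu> (transition M X) t a b \<notin> nbhd n \<mu> \<delta>}
                  \<le> ennreal (K * real n))))"
proof (intro exI[of _ "4 / \<delta>"] conjI allI impI ballI)
  show "0 < 4 / \<delta>" using assms by simp
next
  fix n :: nat and M :: "nat \<Rightarrow> (real \<Rightarrow> nat) measure" and X :: "real \<Rightarrow> (real \<Rightarrow> nat) \<Rightarrow> nat"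
    and \<nu> :: "nat \<Rightarrow> real"
  assume "irreducible_reversible_chain n M X \<nu>"
  then interpret irreducible_reversible_chain n M X \<nu> .
  obtain J :: "nat set" and r where "finite J" "card J = n - 1" "\<forall>l\<in>J. 0 \<le> r l \<and> r l \<le> (1 :: real)"
    "\<forall>t>0. mean_sq_dist n \<nu> (transition M X) t = (\<Sum>l\<in>J. r l powr t)"
    using mean_sq_dist_spectral by blast
  then show "log_time {t. 0 \<le> t \<and> mean_sq_dist n \<nu> (transition M X) t \<notin> nbhd_L n \<delta>}
    \<le> ennreal (4 / \<delta> * real n)"
    using assms n_pos by (intro log_time_unit_powr_sum_notin_nbhd_L) auto
next
  fix n :: nat and M :: "nat \<Rightarrow> (real \<Rightarrow> nat) measure" and X :: "real \<Rightarrow> (real \<Rightarrow> nat) \<Rightarrow> nat"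
    and \<nu> lam :: "nat \<Rightarrow> real" and v a b and \<mu> :: "nat \<Rightarrow> real"
  assume "irreducible_reversible_chain n M X \<nu>"
    and basis: "joint_eigenbasis n \<nu> (transition M X) lam v"
    and "a \<in> {1..n}" "b \<in> {1..n}" "expansion_coeffs n \<nu> v a b \<mu>"
  then interpret irreducible_reversible_chain n M X \<nu> by simp
  have lam: "0 < lam l" if "l \<in> {2..n}" for l
    using basis that by (simp add: joint_eigenbasis_def)
  have mono: "lam l \<le> lam m" if "l \<in> {2..n}" "m \<in> {2..n}" "l \<le> m" for l m
    using basis that by (auto simp: joint_eigenbasis_def mono_on_def)
  show "log_time {t. 0 \<le> t \<and> sq_dist n \<nu> (transition M X) t a b \<notin> nbhd n \<mu> \<delta>}
    \<le> ennreal (4 / \<delta> * real n)"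
  \<comment> \<open>The bases are the squared eigenvalues at time 1; they are at most 1 because
    \<open>lam\<close> is positive on {2..n} and nonincreasing in l because \<open>lam\<close> is
    nondecreasing there.\<close>
  proof (rule log_time_powr_sum_notin_nbhd[where r = "\<lambda>l. exp (- 2 * lam l)"])
    show "sq_dist n \<nu> (transition M X) t a b = (\<Sum>l\<in>{2..n}. (\<mu> l)\<^sup>2 * exp (- 2 * lam l) powr t)"
      if "0 < t" for t
      using sq_dist_spectral[OF basis] \<open>expansion_coeffs n \<nu> v a b \<mu>\<close> \<open>a \<in> {1..n}\<close> \<open>b \<in> {1..n}\<close> that
      by simp
  qed (use assms n_pos lam mono in \<open>auto simp: less_imp_le\<close>)
qed

end
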